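(* Let $k\in\mathbb N$ and let $\mathcal K$ be a proper missing-digit fractal in $[0,1]^k$ whose Cantor--Lebesgue measure $\mu$ satisfies $\dim_{\ell^1}(\mu)>k-\frac{k}{k+1}$. Then there exists $\varepsilon>0$ such that \[ \mu\big(W_k^{\mathcal K}(\tau)\big)=0\qquad\text{for all }\tau>\frac1k-\varepsilon. \]
   Context: A missing-digit fractal is a set $\mathcal K_{b,\mathcal D}=\{\sum_{j\geqslant1}\mathbf d^{(j)}b^{-j}:\mathbf d^{(j)}\in\mathcal D\}\subseteq[0,1]^k$ with integers $b\geqslant2$ and nonempty $\mathcal D\subseteq\{0,1,\dots,b-1\}^k$; its Cantor--Lebesgue measure is the law of $\sum_{j\geqslant1}\mathbf d^{(j)}b^{-j}$ with $\mathbf d^{(j)}$ i.i.d. uniform on $\mathcal D$. It is proper if $\#\mathcal K\geqslant2$ and $\mathcal K\neq[0,1]^k$. For a Borel probability measure $\nu$ on $[0,1]^k$, $\hat\nu({\boldsymbol{\xi}})=\int e^{-2\pi i{\boldsymbol{\xi}}\cdot\mathbf x}\,d\nu(\mathbf x)$ and $\dim_{\ell^1}(\nu)=\sup\{s\geqslant0:\sum_{{\boldsymbol{\xi}}\in\mathbb Z^k,\|{\boldsymbol{\xi}}\|_\infty\leqslant Q}|\hat\nu({\boldsymbol{\xi}})|\ll Q^{k-s}\ (Q\geqslant1)\}$. For $\tau>0$, $W_k^{\mathcal K}(\tau)$ is the set of $\mathbf x\in[0,1)^k$ such that \[ \max_{1\leqslant j\leqslant k}\Big|x_j-\frac{a_j}{n}\Big|<\frac{n^{-\tau}}{n}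 \] holds for infinitely many $(a_1,\dots,a_k,n)\in\mathbb Z^k\times\mathbb N$ with $(a_1/n,\dots,a_k/n)\in\mathcal K$. *)

theory Defs
  imports "HOL-Probability.Probability"
begin

text \<open>Digit vectors are elements of nat^'n; the dimension k is CARD('n).\<close>

definition digit_vec :: "nat ^ 'n \<Rightarrow> real ^ 'n" where
  "digit_vec d = (\<chi> i. real (d $ i))"

definition digit_expansion :: "nat \<Rightarrow> (nat \<Rightarrow> nat ^ 'n) \<Rightarrow> real ^ 'n" where
  "digit_expansion b d = (\<Sum>j. (1 / real b ^ Suc j) *\<^sub>R digit_vec (d j))"

definition digit_data :: "nat \<Rightarrow> (nat ^ 'n) set \<Rightarrow> bool" where
  "digit_data b D \<longleftrightarrow> b \<ge> 2 \<and> D \<noteq> {} \<and> (\<forall>d\<in>D. \<forall>i. d $ i < b)"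

definition missing_digit_fractal :: "nat \<Rightarrow> (nat ^ 'n) set \<Rightarrow> (real ^ 'n) set" where
  "missing_digit_fractal b D = {digit_expansion b d | d. \<forall>j. d j \<in> D}"

definition unit_cube :: "(real ^ 'n) set" where
  "unit_cube = {x. \<forall>i. 0 \<le> x $ i \<and> x $ i \<le> 1}"

definition proper_fractal :: "(real ^ 'n) set \<Rightarrow> bool" where
  "proper_fractal K \<longleftrightarrow> (\<exists>x\<in>K. \<exists>y\<in>K. x \<noteq> y) \<and> K \<noteq> unit_cube"

definition cantor_lebesgue :: "nat \<Rightarrow> (nat ^ 'n) set \<Rightarrow> (real ^ 'n) measure" where
  "cantor_lebesgue b D =
     distr (PiM UNIV (\<lambda>_::nat. measure_pmf (pmf_of_set D))) borel (digit_expansion b)"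

definition fourier_coeff :: "(real ^ 'n) measure \<Rightarrow> int ^ 'n \<Rightarrow> complex" where
  "fourier_coeff \<nu> \<xi> =
     integral\<^sup>L \<nu> (\<lambda>x. cis (- 2 * pi * (\<Sum>i\<in>UNIV. real_of_int (\<xi> $ i) * x $ i)))"

definition l1_dim :: "(real ^ 'n) measure \<Rightarrow> real" where
  "l1_dim \<nu> = Sup {s. s \<ge> 0 \<and> (\<exists>C. \<forall>Q::real. Q \<ge> 1 \<longrightarrow>
       (\<Sum>\<xi>\<in>{\<xi>::int ^ 'n. \<forall>i. real_of_int \<bar>\<xi> $ i\<bar> \<le> Q}. cmod (fourier_coeff \<nu> \<xi>))
         \<le> C * Q powr (real CARD('n) - s))}"

definition W_set :: "(real ^ 'n) set \<Rightarrow> real \<Rightarrow> (real ^ 'n) set" where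
  "W_set K \<tau> = {x. (\<forall>i. 0 \<le> x $ i \<and> x $ i < 1) \<and>
     infinite {(a, n). (a :: int ^ 'n) \<in> UNIV \<and> (n::nat) \<ge> 1 \<and>
        (\<chi> i. real_of_int (a $ i) / real n) \<in> K \<and>
        (\<forall>i. \<bar>x $ i - real_of_int (a $ i) / real n\<bar> < real n powr (- \<tau>) / real n)}}"

end

theory Submission
  imports Defs "HOL-Computational_Algebra.Primes"
begin

text \<open>
  Write \<open>k\<close> for the dimension and \<open>card D = b powr s\<close>, so that \<open>s < k\<close> because the fractal \<open>K\<close>
  is proper. Integrating the translates of a product of Fejer kernels of degree \<open>M\<close> to all points
  \<open>a / n\<close> leaves only the Fourier coefficients at multiples of \<open>n\<close>. Summing over \<open>n \<sim> N\<close>, with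
  the divisor bound for the nonzero frequencies, gives a total \<open>\<mu>\<close>-mass of
  order at most \<open>N^(k+1) M^(-k) + N^k M^(\<delta>-l)\<close> for the cubes of side \<open>1 / M\<close> around rational points of height
  \<open>N\<close>, for each \<open>l\<close> below the l1-dimension. As cubes centred in \<open>K\<close> have mass comparable to
  \<open>M^(-s)\<close>, this bounds the number of rational points in \<open>K\<close>. At \<open>M = N^(1+1/k)\<close> the resulting mass
  of the cubes of side \<open>N^(-1-1/k)\<close> is only bounded, by the first term. Counting at a
  slightly finer scale \<open>M = N^\<theta>\<close>, \<open>\<theta> > 1 + 1/k\<close>, gains the factor \<open>(M / N^(1+1/k))^(s-k)\<close>, which
  is a negative power of \<open>N\<close>, and the second term remains negligible since \<open>(1 + 1/k) l > k\<close>. So there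
  is room to lower \<open>\<tau>\<close> below \<open>1/k\<close>, and the Borel--Cantelli lemma applies.
\<close>

subsection \<open>Divisor bound\<close>

text \<open>A divisor of \<open>p * m\<close> not divisible by \<open>p\<close> is coprime to
  \<open>p\<close> and so divides \<open>m\<close>; every other divisor is \<open>p\<close> times a
  divisor of \<open>m\<close>.\<close>

lemma card_divisors_prime_mult:
  fixes p m :: nat
  assumes "prime p" "m > 0"
  shows "card {d. d dvd p * m} \<le> 2 * card {d. d dvd m}"
proof -
  have "{d. d dvd p * m} \<subseteq> {d. d dvd m} \<union> (*) p ` {d. d dvd m}"
  proof
    fix d assume "d \<in> {d. d dvd p * m}"
    then have d: "d dvd p * m" by simp
    show "d \<in> {d. d dvd m} \<union> (*) p ` {d. d dvd m}"
    proof (cases "p dvd d")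
      case True
      then obtain e where "d = p * e" by auto
      with d assms show ?thesis by (auto simp: prime_gt_0_nat)
    next
      case False
      then have "coprime d p" using assms by (metis coprime_commute prime_imp_coprime)
      with d show ?thesis by (simp add: coprime_dvd_mult_right_iff)
    qed
  qed
  then have "card {d. d dvd p * m} \<le> card ({d. d dvd m} \<union> (*) p ` {d. d dvd m})"
    using assms by (intro card_mono) auto
  also have "\<dots> \<le> card {d. d dvd m} + card ((*) p ` {d. d dvd m})" by (rule card_Un_le)
  also have "\<dots> \<le> card {d. d dvd m} + card {d. d dvd m}"
    using assms by (intro add_left_mono card_image_le) auto
  finally show ?thesis by simp
qed

text \<open>Any divisor of the product splits as \<open>p ^ i * d\<close> with
  \<open>i \<le> e\<close> and \<open>d\<close> dividing \<open>m\<close>, so there are at most as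
  many as such pairs.\<close>

lemma card_divisors_prime_power_mult:
  fixes p m :: nat
  assumes "prime p" "m > 0" "\<not> p dvd m"
  shows "card {d. d dvd p ^ e * m} \<le> (e + 1) * card {d. d dvd m}"
proof -
  have "{d. d dvd p ^ e * m} \<subseteq> (\<lambda>(i, d). p ^ i * d) ` ({..e} \<times> {d. d dvd m})"
  proof
    fix d assume "d \<in> {d. d dvd p ^ e * m}"
    then obtain x y where "d = x * y" "x dvd p ^ e" "y dvd m"
      by (metis mem_Collect_eq division_decomp)
    with assms show "d \<in> (\<lambda>(i, d). p ^ i * d) ` ({..e} \<times> {d. d dvd m})"
      by (auto simp: divides_primepow_nat)
  qed
  then have "card {d. d dvd p ^ e * m} \<le> card ((\<lambda>(i, d). p ^ i * d) ` ({..e} \<times> {d. d dvd m}))"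
    using assms by (intro card_mono) auto
  also have "\<dots> \<le> card ({..e} \<times> {d. d dvd m})"
    using assms by (intro card_image_le) auto
  finally show ?thesis by (simp only: card_cartesian_product card_atMost Suc_eq_plus1)
qed

text \<open>Prime factors are removed one at a time. Each removal costs a factor 2 in the divisor
  count, which \<open>p powr \<delta>\<close> pays for.\<close>

lemma card_divisors_large_primes:
  fixes \<delta> :: real and m :: nat
  assumes "m > 0" "\<And>p. prime p \<Longrightarrow> p dvd m \<Longrightarrow> real p powr \<delta> \<ge> 2"
  shows "real (card {d. d dvd m}) \<le> real m powr \<delta>"
  using assms
proof (induction m rule: less_induct)
  case (less m)
  show ?case
  proof (cases "m = 1")
    case False
    then obtain p where p: "prime p" "p dvd m" using prime_factor_nat by blast
    then obtain r where r: "m = p * r" by auto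
    have "r > 0" "r < m" using r less.prems p prime_gt_1_nat[of p] by auto
    then have IH: "real (card {d. d dvd r}) \<le> real r powr \<delta>"
      using less.prems(2) r by (intro less.IH) auto
    have "real (card {d. d dvd m}) \<le> 2 * real (card {d. d dvd r})"
      using card_divisors_prime_mult[OF p(1) \<open>r > 0\<close>] unfolding r by linarith
    also have "\<dots> \<le> real p powr \<delta> * real r powr \<delta>"
      using IH less.prems(2)[OF p] by (intro mult_mono) auto
    finally show ?thesis by (simp add: r powr_mult)
  qed simp
qed

text \<open>Induction on \<open>B\<close>, the threshold below which primes are exempt from
  \<open>p powr \<delta> \<ge> 2\<close>. Raising it past a prime \<open>B\<close> splits off the
  full power \<open>B ^ e\<close>, whose \<open>e + 1\<close> divisors are bounded by a constant
  times \<open>(B ^ e) powr \<delta>\<close>.\<close>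

lemma card_divisors_small_primes:
  fixes \<delta> :: real
  assumes "\<delta> > 0"
  shows "\<exists>C>0. \<forall>m::nat. m > 0 \<longrightarrow> (\<forall>p. prime p \<longrightarrow> p dvd m \<longrightarrow> p < B \<or> real p powr \<delta> \<ge> 2) \<longrightarrow>
           real (card {d. d dvd m}) \<le> C * real m powr \<delta>"
proof (induction B)
  case 0
  then show ?case using card_divisors_large_primes by (intro exI[of _ 1]) auto
next
  case (Suc B)
  then obtain C where C: "C > 0" "\<And>m::nat. m > 0 \<Longrightarrow> (\<And>p. prime p \<Longrightarrow> p dvd m \<Longrightarrow> p < B \<or> real p powr \<delta> \<ge> 2) \<Longrightarrow>
           real (card {d. d dvd m}) \<le> C * real m powr \<delta>" by metis
  show ?case
  proof (cases "prime B")
    case False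
    have "real (card {d. d dvd m}) \<le> C * real m powr \<delta>"
      if "m > 0" "\<forall>p. prime p \<longrightarrow> p dvd m \<longrightarrow> p < Suc B \<or> real p powr \<delta> \<ge> 2" for m
      using that False by (intro C(2)) (auto simp: less_Suc_eq)
    with C(1) show ?thesis by blast
  next
    case True
    \<comment> \<open>Fitted to \<open>1 + x \<le> exp x\<close> at
      \<open>x = e * \<delta> * ln B\<close>: the second entry handles \<open>e\<close>, the first
      handles the added 1.\<close>
    define A where "A = max 1 (1 / (\<delta> * ln (real B)))"
    have lnB: "\<delta> * ln (real B) > 0"
      using assms prime_gt_1_nat[OF True] by (intro mult_pos_pos ln_gt_zero) auto
    have power: "real e + 1 \<le> A * real (B ^ e) powr \<delta>" for e
    proof -
      have "real e = 1 / (\<delta> * ln (real B)) * (real e * (\<delta> * ln (real B)))"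
        using lnB by (metis less_irrefl mult.left_commute mult.right_neutral nonzero_mult_div_cancel_left times_divide_eq_right mult.commute)
      also have "\<dots> \<le> A * (real e * (\<delta> * ln (real B)))"
        using lnB by (intro mult_right_mono) (auto simp: A_def)
      finally have "real e + 1 \<le> A * (1 + real e * (\<delta> * ln (real B)))"
        by (simp add: distrib_left) (simp add: A_def)
      also have "\<dots> \<le> A * exp (real e * (\<delta> * ln (real B)))"
        by (intro mult_left_mono exp_ge_add_one_self) (auto simp: A_def)
      also have "exp (real e * (\<delta> * ln (real B))) = real (B ^ e) powr \<delta>"
        using prime_gt_0_nat[OF True] by (simp add: powr_def ln_realpow mult_ac)
      finally show ?thesis .
    qed
    have "real (card {d. d dvd m}) \<le> (A * C) * real m powr \<delta>"
      if m: "m > 0" "\<forall>p. prime p \<longrightarrow> p dvd m \<longrightarrow> p < Suc B \<or> real p powr \<delta> \<ge> 2" for m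
    proof -
      obtain r where r: "m = B ^ multiplicity B m * r" "\<not> B dvd r"
        using multiplicity_decompose'[of m B] m True by (metis not_prime_unit less_numeral_extra(3))
      let ?e = "multiplicity B m"
      have "r > 0" using r m by (auto intro: Nat.gr0I)
      have r_le: "real (card {d. d dvd r}) \<le> C * real r powr \<delta>"
      proof (rule C(2)[OF \<open>r > 0\<close>])
        fix p assume p: "prime p" "p dvd r"
        then have "p dvd m" using r(1) by (metis dvd_mult)
        moreover have "p \<noteq> B" using p r by auto
        ultimately show "p < B \<or> real p powr \<delta> \<ge> 2" using m(2) p by (auto simp: less_Suc_eq)
      qed
      have "card {d. d dvd m} \<le> (?e + 1) * card {d. d dvd r}"
        using card_divisors_prime_power_mult[OF True \<open>r > 0\<close> r(2), of ?e] r(1) by simp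
      then have "real (card {d. d dvd m}) \<le> real ((?e + 1) * card {d. d dvd r})"
        by (simp only: of_nat_le_iff)
      also have "\<dots> = (real ?e + 1) * real (card {d. d dvd r})" by (simp add: algebra_simps)
      also have "\<dots> \<le> (A * real (B ^ ?e) powr \<delta>) * (C * real r powr \<delta>)"
        using power r_le by (intro mult_mono) (auto simp: A_def)
      also have "\<dots> = (A * C) * (real (B ^ ?e) * real r) powr \<delta>"
        by (simp add: powr_mult)
      also have "real (B ^ ?e) * real r = real m" using r(1) by (metis of_nat_mult)
      finally show ?thesis .
    qed
    moreover have "A * C > 0" using C(1) by (auto simp: A_def)
    ultimately show ?thesis by blast
  qed
qed

lemma divisor_bound:
  fixes \<delta> :: real
  assumes "\<delta> > 0"
  obtains C where "C > 0" "\<And>m::nat. m > 0 \<Longrightarrow> real (card {d. d dvd m}) \<le> C * real m powr \<delta>"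
proof -
  \<comment> \<open>From this threshold on \<open>p powr \<delta> \<ge> 2\<close> holds
    automatically, so the preceding lemma covers every \<open>m > 0\<close>.\<close>
  define B where "B = nat \<lceil>2 powr (1 / \<delta>)\<rceil>"
  have "real p powr \<delta> \<ge> 2" if "p \<ge> B" for p
  proof -
    have "(2::real) = (2 powr (1 / \<delta>)) powr \<delta>" using assms by (simp add: powr_powr)
    also have "\<dots> \<le> real p powr \<delta>" 
    proof (intro powr_mono2)
      show "2 powr (1 / \<delta>) \<le> real p"
        using that real_nat_ceiling_ge[of "2 powr (1 / \<delta>)"] unfolding B_def by linarith
    qed (use assms in auto)
    finally show ?thesis .
  qed
  then show ?thesis
    using card_divisors_small_primes[OF assms, of B] that by (metis not_le_imp_less)
qed

subsection \<open>Translates of the Fejer kernel\<close>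

text \<open>The classical Fejer kernel divided by \<open>M\<close>, so that its value at integers is
  1 for \<open>M \<ge> 1\<close>.\<close>

definition fejer :: "nat \<Rightarrow> real \<Rightarrow> real" where
  "fejer M t = (cmod (\<Sum>j<M. cis (2 * pi * real j * t)))\<^sup>2 / (real M)\<^sup>2"

lemma fejer_nonneg: "fejer M t \<ge> 0"
  by (simp add: fejer_def)

text \<open>All phases lie within \<open>pi / 4\<close> of 0, where the cosine is at least
  \<open>cos (pi / 3) = 1 / 2\<close>; hence the real part of the exponential sum is at least
  \<open>M / 2\<close>.\<close>

lemma fejer_ge_quarter:
  assumes "M \<ge> 1" "\<bar>t\<bar> \<le> 1 / (8 * real M)"
  shows "fejer M t \<ge> 1 / 4"
proof -
  have half: "cos (2 * pi * real j * t) \<ge> 1 / 2" if "j < M" for j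
  proof -
    have "\<bar>2 * pi * real j * t\<bar> = 2 * pi * (real j * \<bar>t\<bar>)"
      by (simp add: abs_mult)
    also have "real j * \<bar>t\<bar> \<le> real M * (1 / (8 * real M))"
      using that assms by (intro mult_mono) auto
    also have "\<dots> = 1 / 8" using assms by simp
    finally have "\<bar>2 * pi * real j * t\<bar> \<le> pi / 4" by simp
    then have "cos (pi / 3) \<le> cos \<bar>2 * pi * real j * t\<bar>"
      by (intro cos_monotone_0_pi_le) auto
    then show ?thesis by (simp add: cos_60)
  qed
  have "real M / 2 = (\<Sum>j<M. 1 / 2 :: real)" by simp
  also have "\<dots> \<le> (\<Sum>j<M. cos (2 * pi * real j * t))"
    by (intro sum_mono half) auto
  also have "\<dots> = Re (\<Sum>j<M. cis (2 * pi * real j * t))" by simp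
  also have "\<dots> \<le> cmod (\<Sum>j<M. cis (2 * pi * real j * t))" by (rule complex_Re_le_cmod)
  finally have "(real M / 2)\<^sup>2 \<le> (cmod (\<Sum>j<M. cis (2 * pi * real j * t)))\<^sup>2"
    by (intro power_mono) auto
  then show ?thesis
    using assms by (simp add: fejer_def field_simps power2_eq_square)
qed

text \<open>This is \<open>z * cnj z\<close> multiplied out. The frequencies stay indexed by pairs
  and are grouped by difference only after summing over translates; the sign is that of
  \<open>fourier_coeff\<close>.\<close>

lemma fejer_double_sum:
  "complex_of_real (fejer M t) =
     (\<Sum>(p, r)\<in>{..<M} \<times> {..<M}. cis (- 2 * pi * real_of_int (int r - int p) * t)) / (of_nat M)\<^sup>2"
proof -
  have "complex_of_real ((cmod (\<Sum>j<M. cis (2 * pi * real j * t)))\<^sup>2) =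
     (\<Sum>p<M. cis (2 * pi * real p * t)) * (\<Sum>r<M. cis (- (2 * pi * real r * t)))"
    by (simp only: complex_norm_square cnj_sum cis_cnj)
  also have "\<dots> = (\<Sum>p<M. \<Sum>r<M. cis (- 2 * pi * real_of_int (int r - int p) * t))"
    by (simp add: sum_product cis_mult algebra_simps)
  finally show ?thesis
    by (simp add: fejer_def sum.cartesian_product)
qed

lemma prod_cis: "(\<Prod>i\<in>A. cis (f i)) = cis (\<Sum>i\<in>A. f i)"
  by (induction A rule: infinite_finite_induct) (auto simp: cis_mult)

text \<open>Orthogonality of characters modulo \<open>n\<close>, over two full periods. The range up
  to \<open>2 * n\<close> consists of whole periods and still contains the numerators
  \<open>0\<close> to \<open>n\<close> of all fractions in the closed unit interval.\<close>

lemma sum_cis_multiples: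
  fixes j :: int
  assumes "n \<ge> 1"
  shows "(\<Sum>a\<in>{0..<2 * int n}. cis (2 * pi * real_of_int j * (real_of_int a / real n))) =
         (if int n dvd j then of_nat (2 * n) else 0)"
proof -
  let ?z = "cis (2 * pi * real_of_int j / real n)"
  have "(\<Sum>a\<in>{0..<2 * int n}. cis (2 * pi * real_of_int j * (real_of_int a / real n))) =
      (\<Sum>a<2 * n. cis (2 * pi * real_of_int j * (real a / real n)))"
    by (rule sum.reindex_bij_witness[of _ int nat]) auto
  also have "\<dots> = (\<Sum>a<2 * n. ?z ^ a)"
  proof (intro sum.cong refl)
    fix a
    have "?z ^ a = cis (real a * (2 * pi * real_of_int j / real n))" by (rule Complex.DeMoivre)
    then show "cis (2 * pi * real_of_int j * (real a / real n)) = ?z ^ a" by (simp add: mult_ac)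
  qed
  also have "\<dots> = (if int n dvd j then of_nat (2 * n) else 0)"
  proof (cases "int n dvd j")
    case True
    then obtain c where "j = int n * c" by auto
    then have "2 * pi * real_of_int j / real n = 2 * pi * real_of_int c" using assms by simp
    then have "?z = cis (2 * pi * real_of_int c)" by (rule arg_cong)
    also have "\<dots> = 1" by (rule cis_multiple_2pi) auto
    finally show ?thesis using True by simp
  next
    case False
    have "?z \<noteq> 1"
    proof
      assume "?z = 1"
      then have "cos (2 * pi * real_of_int j / real n) = 1"
        by (metis cis.simps(1) one_complex.simps(1))
      then obtain c :: int where "2 * pi * real_of_int j / real n = real_of_int c * 2 * pi"
        unfolding cos_one_2pi_int by blast
      then have "real_of_int j = real_of_int (int n * c)"
        using assms by (simp add: field_simps)
      then have "j = int n * c" by (simp only: of_int_eq_iff)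
      with False show False by simp
    qed
    moreover have "?z ^ (2 * n) = 1"
    proof -
      have "?z ^ (2 * n) = cis (2 * pi * real_of_int (2 * j))"
        using assms unfolding Complex.DeMoivre by (intro arg_cong[of _ _ cis]) simp
      also have "\<dots> = 1" by (rule cis_multiple_2pi) auto
      finally show ?thesis .
    qed
    ultimately show ?thesis using False by (simp add: geometric_sum)
  qed
  finally show ?thesis .
qed

text \<open>Summing over the translates kills all frequencies not divisible by \<open>n\<close>. A
  surviving frequency arises from at most \<open>M\<close> of the \<open>M ^ 2\<close> pairs,
  because the first entry of a pair with given difference determines the second; this bounds
  \<open>w\<close>.\<close>

lemma sum_fejer_translates:
  assumes "n \<ge> 1" "M \<ge> 1"
  obtains w :: "int \<Rightarrow> real" where "\<And>j. 0 \<le> w j" "\<And>j. w j \<le> 2 * real n / real M"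
    "\<And>t. complex_of_real (\<Sum>a\<in>{0..<2 * int n}. fejer M (t - real_of_int a / real n)) =
      (\<Sum>j\<in>{j. \<bar>j\<bar> \<le> int M \<and> int n dvd j}. of_real (w j) * cis (- 2 * pi * (real_of_int j * t)))"
proof -
  let ?P = "{..<M} \<times> {..<M}"
  define g where "g = (\<lambda>(p, r). int r - int p)"
  define m where "m j = card {x \<in> ?P. g x = j}" for j
  define w where "w j = 2 * real n * real (m j) / (real M)\<^sup>2" for j
  have m_le: "m j \<le> M" for j
  proof -
    have "inj_on fst {x \<in> ?P. g x = j}" by (auto simp: inj_on_def g_def)
    then have "m j = card (fst ` {x \<in> ?P. g x = j})" by (simp add: card_image m_def)
    also have "\<dots> \<le> card {..<M}" by (intro card_mono) auto
    finally show ?thesis by simp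
  qed
  let ?J = "{j. \<bar>j\<bar> \<le> int M \<and> int n dvd j}"
  have "complex_of_real (\<Sum>a\<in>{0..<2 * int n}. fejer M (t - real_of_int a / real n)) =
      (\<Sum>j\<in>?J. of_real (w j) * cis (- 2 * pi * (real_of_int j * t)))" for t
  proof -
    have "complex_of_real (\<Sum>a\<in>{0..<2 * int n}. fejer M (t - real_of_int a / real n)) =
       (\<Sum>a\<in>{0..<2 * int n}. \<Sum>x\<in>?P. cis (- 2 * pi * (real_of_int (g x) * t)) *
           cis (2 * pi * real_of_int (g x) * (real_of_int a / real n))) / (of_nat M)\<^sup>2"
      unfolding of_real_sum fejer_double_sum sum_divide_distrib[symmetric]
      by (intro arg_cong2[where f = "(/)"] sum.cong refl)
         (auto simp: g_def cis_mult algebra_simps diff_divide_distrib)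
    also have "\<dots> = (\<Sum>x\<in>?P. cis (- 2 * pi * (real_of_int (g x) * t)) *
           (if int n dvd g x then of_nat (2 * n) else 0)) / (of_nat M)\<^sup>2"
      by (subst sum.swap) (simp only: sum_distrib_left[symmetric] sum_cis_multiples[OF assms(1)])
    also have "\<dots> = (\<Sum>j\<in>{-int M..int M}. \<Sum>x\<in>{x \<in> ?P. g x = j}. cis (- 2 * pi * (real_of_int (g x) * t)) *
           (if int n dvd g x then of_nat (2 * n) else 0)) / (of_nat M)\<^sup>2"
      by (subst sum.group) (auto simp: g_def)
    also have "\<dots> = (\<Sum>j\<in>{-int M..int M}. of_nat (m j) * (cis (- 2 * pi * (real_of_int j * t)) *
           (if int n dvd j then of_nat (2 * n) else 0))) / (of_nat M)\<^sup>2"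
      by (simp add: m_def)
    also have "\<dots> = (\<Sum>j\<in>{-int M..int M}. if int n dvd j then
        of_real (w j) * cis (- 2 * pi * (real_of_int j * t)) else 0)"
      unfolding sum_divide_distrib by (intro sum.cong) (auto simp: w_def)
    also have "\<dots> = (\<Sum>j\<in>?J. of_real (w j) * cis (- 2 * pi * (real_of_int j * t)))"
      by (subst sum.inter_filter[symmetric]) (auto intro!: sum.cong)
    finally show ?thesis .
  qed
  moreover have "w j \<le> 2 * real n / real M" for j
  proof -
    have "w j \<le> 2 * real n * real M / (real M)\<^sup>2"
      unfolding w_def using m_le[of j] by (intro divide_right_mono mult_left_mono) auto
    then show ?thesis using assms by (simp add: power2_eq_square)
  qed
  moreover have "0 \<le> w j" for j by (simp add: w_def)
  ultimately show ?thesis using that by blast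
qed

section \<open>Finite boxes of vectors and products of sums over them\<close>

lemma finite_vec_bounded:
  assumes "finite S"
  shows "finite {v :: 'a ^ 'n::finite. \<forall>i. v $ i \<in> S}"
proof (rule finite_surj)
  show "finite (PiE (UNIV :: 'n set) (\<lambda>_. S))" using assms by (intro finite_PiE) auto
  show "{v :: 'a ^ 'n. \<forall>i. v $ i \<in> S} \<subseteq> vec_lambda ` PiE UNIV (\<lambda>_. S)"
    by (auto intro!: image_eqI[where x = "vec_nth _"])
qed

lemma prod_sum_vec:
  fixes g :: "'n::finite \<Rightarrow> 'a \<Rightarrow> 'b::comm_semiring_1"
  assumes "finite S"
  shows "(\<Prod>i\<in>UNIV. \<Sum>j\<in>S. g i j) = (\<Sum>v\<in>{v :: 'a ^ 'n. \<forall>i. v $ i \<in> S}. \<Prod>i\<in>UNIV. g i (v $ i))"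
proof -
  have "(\<Prod>i\<in>UNIV. \<Sum>j\<in>S. g i j) = (\<Sum>f\<in>PiE UNIV (\<lambda>_. S). \<Prod>i\<in>UNIV. g i (f i))"
    using assms by (intro prod_sum_PiE) auto
  also have "\<dots> = (\<Sum>v\<in>{v :: 'a ^ 'n. \<forall>i. v $ i \<in> S}. \<Prod>i\<in>UNIV. g i (v $ i))"
    by (rule sum.reindex_bij_witness[of _ vec_nth vec_lambda]) auto
  finally show ?thesis .
qed

lemma card_vec_bounded:
  assumes "finite S"
  shows "card {v :: 'a ^ 'n::finite. \<forall>i. v $ i \<in> S} = card S ^ CARD('n)"
  using prod_sum_vec[OF assms, of "\<lambda>(_::'n) _. 1 :: nat"] by simp

subsection \<open>Counting rational points by Fourier coefficients\<close>

lemma finite_int_vec_bounded: "finite {\<xi> :: int ^ 'n. \<forall>i. \<bar>\<xi> $ i\<bar> \<le> int M}"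
  by (rule finite_subset[OF _ finite_vec_bounded[of "{-int M..int M}"]]) (auto simp: abs_le_iff minus_le_iff)

text \<open>The entries are at most \<open>n\<close>; the wider range is the one over which the
  Fejer translates are summed.\<close>

lemma rational_points_numerators:
  fixes K :: "(real ^ 'n) set"
  assumes "K \<subseteq> unit_cube" "n \<ge> 1"
  shows "{a :: int ^ 'n. (\<chi> i. real_of_int (a $ i) / real n) \<in> K} \<subseteq> {a. \<forall>i. a $ i \<in> {0..<2 * int n}}"
proof (clarify)
  fix a :: "int ^ 'n" and i
  assume "(\<chi> i. real_of_int (a $ i) / real n) \<in> K"
  then have "0 \<le> real_of_int (a $ i) / real n \<and> real_of_int (a $ i) / real n \<le> 1"
    using assms by (force simp: unit_cube_def)
  then have "0 \<le> a $ i \<and> a $ i \<le> int n"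
    using assms by (auto simp: field_simps zero_le_divide_iff)
  then show "a $ i \<in> {0..<2 * int n}" using assms by auto
qed

lemma continuous_fejer: "continuous_on UNIV (fejer M)"
  unfolding fejer_def [abs_def] cis_conv_exp divide_inverse by (intro continuous_intros)

text \<open>The product kernel centred at a point of \<open>K\<close> has integral at least
  \<open>c / 4 ^ CARD('n)\<close>, as each factor is at least \<open>1 / 4\<close> on the cube whose
  mass is at least \<open>c\<close>. The total over all numerators is computed on the Fourier side,
  where only frequencies with all entries divisible by \<open>n\<close> remain.\<close>

lemma card_rational_points_denominator:
  fixes \<mu> :: "(real ^ 'n) measure" and K :: "(real ^ 'n) set"
  assumes "prob_space \<mu>" and sets_mu: "sets \<mu> = sets borel" and K: "K \<subseteq> unit_cube"
    and n: "n \<ge> 1" and M: "M \<ge> 1"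
    and c: "\<And>y. y \<in> K \<Longrightarrow> measure \<mu> {x. \<forall>i. \<bar>x $ i - y $ i\<bar> \<le> 1 / (8 * real M)} \<ge> c"
  shows "real (card {a :: int ^ 'n. (\<chi> i. real_of_int (a $ i) / real n) \<in> K}) * (c / 4 ^ CARD('n)) \<le>
    (2 * real n / real M) ^ CARD('n) *
      (\<Sum>\<xi>\<in>{\<xi>. (\<forall>i. \<bar>\<xi> $ i\<bar> \<le> int M) \<and> (\<forall>i. int n dvd \<xi> $ i)}. cmod (fourier_coeff \<mu> \<xi>))"
proof -
  interpret prob_space \<mu> by fact
  note [measurable_cong] = sets_mu
  let ?S = "{0..<2 * int n}" and ?J = "{j. \<bar>j\<bar> \<le> int M \<and> int n dvd j}"
  let ?A = "{a :: int ^ 'n. \<forall>i. a $ i \<in> ?S}" and ?\<Xi> = "{\<xi> :: int ^ 'n. \<forall>i. \<xi> $ i \<in> ?J}"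
  let ?R = "{a :: int ^ 'n. (\<chi> i. real_of_int (a $ i) / real n) \<in> K}"
  define F where "F a x = (\<Prod>i\<in>UNIV. fejer M (x $ i - real_of_int (a $ i) / real n))"
    for a :: "int ^ 'n" and x :: "real ^ 'n"
  obtain w where w: "\<And>j. 0 \<le> w j" "\<And>j. w j \<le> 2 * real n / real M"
    "\<And>t. complex_of_real (\<Sum>a\<in>?S. fejer M (t - real_of_int a / real n)) =
      (\<Sum>j\<in>?J. of_real (w j) * cis (- 2 * pi * (real_of_int j * t)))"
    using sum_fejer_translates[OF n M] by blast
  have finJ: "finite ?J" by (rule finite_subset[of _ "{-int M..int M}"]) (auto simp: abs_le_iff)
  have finA: "finite ?A" by (intro finite_vec_bounded) simp
  have R_sub: "?R \<subseteq> ?A" by (rule rational_points_numerators[OF K n])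
  have F_meas: "F a \<in> borel_measurable \<mu>" for a
  proof -
    have "continuous_on UNIV (F a)"
      unfolding F_def [abs_def]
      by (intro continuous_intros continuous_on_compose2[OF continuous_fejer]) auto
    then show ?thesis by (simp add: borel_measurable_continuous_onI measurable_cong_sets[OF sets_mu refl])
  qed
  have F_nonneg: "F a x \<ge> 0" for a x unfolding F_def by (intro prod_nonneg) (auto simp: fejer_nonneg)
  have fejer_le: "fejer M t \<le> 1" for t
  proof -
    have "cmod (\<Sum>j<M. cis (2 * pi * real j * t)) \<le> (\<Sum>j<M. 1)"
      by (rule order_trans[OF norm_sum]) simp
    then show ?thesis using M by (simp add: fejer_def divide_le_eq power_mono)
  qed
  have F_int: "integrable \<mu> (F a)" for a
  proof (rule integrable_const_bound[OF _ F_meas])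
    have "F a x \<le> 1" for x unfolding F_def
      by (intro prod_le_1) (auto simp: fejer_nonneg fejer_le)
    then show "AE x in \<mu>. norm (F a x) \<le> 1" using F_nonneg by (intro AE_I2) simp
  qed
  have lower: "c / 4 ^ CARD('n) \<le> (\<integral>x. F a x \<partial>\<mu>)" if "a \<in> ?R" for a
  proof -
    let ?y = "(\<chi> i. real_of_int (a $ i) / real n) :: real ^ 'n"
    let ?B = "{x. \<forall>i. \<bar>x $ i - ?y $ i\<bar> \<le> 1 / (8 * real M)}"
    have "closed ?B"
      by (intro closed_Collect_all closed_Collect_le continuous_intros)
    then have B: "?B \<in> sets \<mu>" by (simp add: sets_mu)
    have "c / 4 ^ CARD('n) \<le> measure \<mu> ?B * (1 / 4) ^ CARD('n)"
      using c[of ?y] that by (simp add: power_one_over divide_right_mono)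
    also have "\<dots> = (\<integral>x. indicator ?B x * (1 / 4) ^ CARD('n) \<partial>\<mu>)"
      using B by (simp add: Int_absorb1 sets.sets_into_space)
    also have "\<dots> \<le> (\<integral>x. F a x \<partial>\<mu>)"
    proof (rule integral_mono[OF _ F_int])
      show "integrable \<mu> (\<lambda>x. indicator ?B x * (1 / 4) ^ CARD('n) :: real)"
        using B by (intro integrable_mult_left integrable_real_indicator) (auto simp: emeasure_eq_measure)
      fix x
      show "indicator ?B x * (1 / 4) ^ CARD('n) \<le> F a x"
      proof (cases "x \<in> ?B")
        case True
        have "(1 / 4) ^ CARD('n) = (\<Prod>i\<in>(UNIV :: 'n set). 1 / 4 :: real)" by simp
        also have "\<dots> \<le> F a x" unfolding F_def
          using True M by (intro prod_mono conjI fejer_ge_quarter) auto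
        finally show ?thesis using True by simp
      qed (simp add: F_nonneg)
    qed
    finally show ?thesis .
  qed
  \<comment> \<open>The product of the one-dimensional sums multiplies out to a sum over frequency
    vectors, and the one-dimensional characters combine to the character of the scalar
    product.\<close>
  have expand: "complex_of_real (\<Sum>a\<in>?A. F a x) = (\<Sum>\<xi>\<in>?\<Xi>. of_real (\<Prod>i\<in>UNIV. w (\<xi> $ i)) *
      cis (- 2 * pi * (\<Sum>i\<in>UNIV. real_of_int (\<xi> $ i) * x $ i)))" for x :: "real ^ 'n"
  proof -
    have "(\<Sum>a\<in>?A. F a x) = (\<Prod>i\<in>UNIV. \<Sum>a\<in>?S. fejer M (x $ i - real_of_int a / real n))"
      unfolding F_def by (rule prod_sum_vec[symmetric]) simp
    then have "complex_of_real (\<Sum>a\<in>?A. F a x) =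
        (\<Prod>i\<in>UNIV. \<Sum>j\<in>?J. of_real (w j) * cis (- 2 * pi * (real_of_int j * x $ i)))"
      using w(3) by simp
    also have "\<dots> = (\<Sum>\<xi>\<in>?\<Xi>. \<Prod>i\<in>UNIV. of_real (w (\<xi> $ i)) * cis (- 2 * pi * (real_of_int (\<xi> $ i) * x $ i)))"
      by (rule prod_sum_vec[OF finJ])
    also have "\<dots> = (\<Sum>\<xi>\<in>?\<Xi>. of_real (\<Prod>i\<in>UNIV. w (\<xi> $ i)) *
      cis (- 2 * pi * (\<Sum>i\<in>UNIV. real_of_int (\<xi> $ i) * x $ i)))"
      by (simp add: prod.distrib prod_cis sum_distrib_left sum_negf)
    finally show ?thesis .
  qed
  have cis_int: "integrable \<mu> (\<lambda>x. cis (- 2 * pi * (\<Sum>i\<in>UNIV. real_of_int (\<xi> $ i) * x $ i)))"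
    for \<xi> :: "int ^ 'n"
  proof (rule integrable_const_bound)
    have "continuous_on UNIV (\<lambda>x :: real ^ 'n. cis (- 2 * pi * (\<Sum>i\<in>UNIV. real_of_int (\<xi> $ i) * x $ i)))"
      unfolding cis_conv_exp by (intro continuous_intros)
    then show "(\<lambda>x. cis (- 2 * pi * (\<Sum>i\<in>UNIV. real_of_int (\<xi> $ i) * x $ i))) \<in> borel_measurable \<mu>"
      by (simp only: borel_measurable_continuous_onI measurable_cong_sets[OF sets_mu refl])
  qed auto
  have "real (card ?R) * (c / 4 ^ CARD('n)) = (\<Sum>a\<in>?R. c / 4 ^ CARD('n))" by simp
  also have "\<dots> \<le> (\<Sum>a\<in>?R. \<integral>x. F a x \<partial>\<mu>)" by (intro sum_mono lower)
  \<comment> \<open>Nonnegativity of the kernels allows the remaining numerators to be added; it is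
    the complete sum that has the sparse Fourier expansion.\<close>
  also have "\<dots> \<le> (\<Sum>a\<in>?A. \<integral>x. F a x \<partial>\<mu>)"
    using R_sub finA F_nonneg by (intro sum_mono2) (auto intro!: integral_nonneg_AE)
  also have "\<dots> = (\<integral>x. (\<Sum>a\<in>?A. F a x) \<partial>\<mu>)"
    using F_int by (simp add: Bochner_Integration.integral_sum)
  also have "\<dots> \<le> cmod (complex_of_real (\<integral>x. (\<Sum>a\<in>?A. F a x) \<partial>\<mu>))" by simp
  also have "complex_of_real (\<integral>x. (\<Sum>a\<in>?A. F a x) \<partial>\<mu>) = (\<integral>x. complex_of_real (\<Sum>a\<in>?A. F a x) \<partial>\<mu>)"
    by (rule integral_complex_of_real[symmetric])
  also have "\<dots> = (\<Sum>\<xi>\<in>?\<Xi>. of_real (\<Prod>i\<in>UNIV. w (\<xi> $ i)) * fourier_coeff \<mu> \<xi>)"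
    unfolding expand fourier_coeff_def using cis_int
    by (subst Bochner_Integration.integral_sum) (auto intro!: integrable_mult_right simp del: minus_mult_left)
  also have "cmod \<dots> \<le> (\<Sum>\<xi>\<in>?\<Xi>. (2 * real n / real M) ^ CARD('n) * cmod (fourier_coeff \<mu> \<xi>))"
  proof (rule order_trans[OF norm_sum], rule sum_mono)
    fix \<xi> :: "int ^ 'n"
    have "\<bar>\<Prod>i\<in>UNIV. w (\<xi> $ i)\<bar> \<le> (\<Prod>i\<in>(UNIV :: 'n set). 2 * real n / real M)"
      unfolding abs_prod using w(1,2) by (intro prod_mono) auto
    then show "cmod (of_real (\<Prod>i\<in>UNIV. w (\<xi> $ i)) * fourier_coeff \<mu> \<xi>) \<le>
        (2 * real n / real M) ^ CARD('n) * cmod (fourier_coeff \<mu> \<xi>)"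
      unfolding norm_mult norm_of_real by (intro mult_right_mono) auto
  qed
  also have "\<dots> = (2 * real n / real M) ^ CARD('n) * (\<Sum>\<xi>\<in>?\<Xi>. cmod (fourier_coeff \<mu> \<xi>))"
    by (simp only: sum_distrib_left)
  also have "?\<Xi> = {\<xi>. (\<forall>i. \<bar>\<xi> $ i\<bar> \<le> int M) \<and> (\<forall>i. int n dvd \<xi> $ i)}" by auto
  finally show ?thesis .
qed

lemma fourier_coeff_le_1:
  assumes "prob_space \<mu>"
  shows "cmod (fourier_coeff \<mu> \<xi>) \<le> 1"
proof -
  interpret prob_space \<mu> by fact
  have "cmod (fourier_coeff \<mu> \<xi>) \<le> (\<integral>x. 1 \<partial>\<mu>)"
    unfolding fourier_coeff_def by (rule order_trans[OF integral_norm_bound]) simp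
  then show ?thesis by (simp add: prob_space)
qed

text \<open>After exchanging the sums, a frequency is weighted by the number of \<open>n\<close>
  dividing all its entries. For frequency 0 this is at most \<open>N'\<close>; otherwise such an
  \<open>n\<close> divides a nonzero entry of modulus at most \<open>M\<close>, so the divisor bound
  \<open>C\<close> applies.\<close>

lemma sum_fourier_multiples:
  fixes \<mu> :: "(real ^ 'n) measure"
  assumes "prob_space \<mu>" "N \<ge> 1" "C \<ge> 0"
    and div: "\<And>m::nat. 1 \<le> m \<Longrightarrow> m \<le> M \<Longrightarrow> real (card {d. d dvd m}) \<le> C"
  shows "(\<Sum>n\<in>{N..<N'}. \<Sum>\<xi>\<in>{\<xi> :: int ^ 'n. (\<forall>i. \<bar>\<xi> $ i\<bar> \<le> int M) \<and> (\<forall>i. int n dvd \<xi> $ i)}. cmod (fourier_coeff \<mu> \<xi>))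
     \<le> real N' + C * (\<Sum>\<xi>\<in>{\<xi>. \<forall>i. \<bar>\<xi> $ i\<bar> \<le> int M}. cmod (fourier_coeff \<mu> \<xi>))"
proof -
  let ?X = "{\<xi> :: int ^ 'n. \<forall>i. \<bar>\<xi> $ i\<bar> \<le> int M}"
  let ?f = "\<lambda>\<xi>. cmod (fourier_coeff \<mu> \<xi>)"
  let ?c = "\<lambda>\<xi> :: int ^ 'n. real (card {n \<in> {N..<N'}. \<forall>i. int n dvd \<xi> $ i})"
  have "(\<Sum>n\<in>{N..<N'}. \<Sum>\<xi>\<in>{\<xi> :: int ^ 'n. (\<forall>i. \<bar>\<xi> $ i\<bar> \<le> int M) \<and> (\<forall>i. int n dvd \<xi> $ i)}. ?f \<xi>) =
      (\<Sum>n\<in>{N..<N'}. \<Sum>\<xi>\<in>?X. if \<forall>i. int n dvd \<xi> $ i then ?f \<xi> else 0)"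
    by (rule sum.cong[OF refl], subst sum.inter_filter[symmetric])
       (auto simp: finite_int_vec_bounded intro!: sum.cong)
  also have "\<dots> = (\<Sum>\<xi>\<in>?X. \<Sum>n\<in>{N..<N'}. if \<forall>i. int n dvd \<xi> $ i then ?f \<xi> else 0)"
    by (rule sum.swap)
  also have "\<dots> = (\<Sum>\<xi>\<in>?X. ?c \<xi> * ?f \<xi>)"
    by (rule sum.cong[OF refl], subst sum.inter_filter[symmetric]) auto
  also have "\<dots> \<le> (\<Sum>\<xi>\<in>?X. (if \<xi> = 0 then real N' else 0) + C * ?f \<xi>)"
  proof (intro sum_mono)
    fix \<xi> :: "int ^ 'n" assume \<xi>: "\<xi> \<in> ?X"
    show "?c \<xi> * ?f \<xi> \<le> (if \<xi> = 0 then real N' else 0) + C * ?f \<xi>"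
    proof (cases "\<xi> = 0")
      case True
      have "card {n \<in> {N..<N'}. \<forall>i. int n dvd \<xi> $ i} \<le> card {N..<N'}" by (intro card_mono) auto
      then have "?c \<xi> * ?f \<xi> \<le> real N' * 1"
        using fourier_coeff_le_1[OF assms(1)] by (intro mult_mono) auto
      then show ?thesis using True assms by (simp add: add_increasing2)
    next
      case False
      then obtain i where i: "\<xi> $ i \<noteq> 0" by (auto simp: vec_eq_iff)
      define m where "m = nat \<bar>\<xi> $ i\<bar>"
      have m: "1 \<le> m" "m \<le> M" using i \<xi> by (auto simp: m_def nat_le_iff)
      have "{n \<in> {N..<N'}. \<forall>i. int n dvd \<xi> $ i} \<subseteq> {d. d dvd m}"
        by (auto simp: m_def nat_abs_dvd_iff)
      then have "?c \<xi> \<le> real (card {d. d dvd m})"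
        using m by (intro of_nat_mono card_mono) auto
      also have "\<dots> \<le> C" using div m by blast
      finally show ?thesis using False by (auto intro!: mult_right_mono)
    qed
  qed
  also have "\<dots> = real N' + C * (\<Sum>\<xi>\<in>?X. ?f \<xi>)"
    by (simp add: sum.distrib sum_distrib_left finite_int_vec_bounded)
  finally show ?thesis .
qed

text \<open>The prefactor is made uniform by \<open>n \<le> N'\<close>, so that the frequency sums
  can be added over \<open>n\<close>. The gain from treating a range of denominators together is
  that each nonzero frequency is counted at most \<open>C\<close> times.\<close>

lemma card_rational_points:
  fixes \<mu> :: "(real ^ 'n) measure" and K :: "(real ^ 'n) set"
  assumes "prob_space \<mu>" "sets \<mu> = sets borel" "K \<subseteq> unit_cube" "N \<ge> 1" "M \<ge> 1" "C \<ge> 0"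
    and c: "\<And>y. y \<in> K \<Longrightarrow> measure \<mu> {x. \<forall>i. \<bar>x $ i - y $ i\<bar> \<le> 1 / (8 * real M)} \<ge> c"
    and div: "\<And>m::nat. 1 \<le> m \<Longrightarrow> m \<le> M \<Longrightarrow> real (card {d. d dvd m}) \<le> C"
  shows "(\<Sum>n\<in>{N..<N'}. real (card {a :: int ^ 'n. (\<chi> i. real_of_int (a $ i) / real n) \<in> K})) * (c / 4 ^ CARD('n)) \<le>
    (2 * real N' / real M) ^ CARD('n) *
      (real N' + C * (\<Sum>\<xi>\<in>{\<xi>. \<forall>i. \<bar>\<xi> $ i\<bar> \<le> int M}. cmod (fourier_coeff \<mu> \<xi>)))"
proof -
  let ?f = "\<lambda>\<xi>. cmod (fourier_coeff \<mu> \<xi>)"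
  have "(\<Sum>n\<in>{N..<N'}. real (card {a :: int ^ 'n. (\<chi> i. real_of_int (a $ i) / real n) \<in> K})) * (c / 4 ^ CARD('n))
    \<le> (\<Sum>n\<in>{N..<N'}. (2 * real N' / real M) ^ CARD('n) *
      (\<Sum>\<xi>\<in>{\<xi>. (\<forall>i. \<bar>\<xi> $ i\<bar> \<le> int M) \<and> (\<forall>i. int n dvd \<xi> $ i)}. ?f \<xi>))"
    unfolding sum_distrib_right
  proof (intro sum_mono)
    fix n assume n: "n \<in> {N..<N'}"
    have "(2 * real n / real M) ^ CARD('n) \<le> (2 * real N' / real M) ^ CARD('n)"
      using n by (intro power_mono divide_right_mono) auto
    moreover have "(\<Sum>\<xi>\<in>{\<xi>. (\<forall>i. \<bar>\<xi> $ i\<bar> \<le> int M) \<and> (\<forall>i. int n dvd \<xi> $ i)}. ?f \<xi>) \<ge> 0"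
      by (intro sum_nonneg) auto
    ultimately show "real (card {a :: int ^ 'n. (\<chi> i. real_of_int (a $ i) / real n) \<in> K}) * (c / 4 ^ CARD('n)) \<le>
      (2 * real N' / real M) ^ CARD('n) *
      (\<Sum>\<xi>\<in>{\<xi>. (\<forall>i. \<bar>\<xi> $ i\<bar> \<le> int M) \<and> (\<forall>i. int n dvd \<xi> $ i)}. ?f \<xi>)"
      using card_rational_points_denominator[OF assms(1,2,3) _ assms(5) c, of n] n assms(4)
      by (meson atLeastLessThan_iff mult_right_mono order_trans)
  qed
  also have "\<dots> \<le> (2 * real N' / real M) ^ CARD('n) *
      (real N' + C * (\<Sum>\<xi>\<in>{\<xi>. \<forall>i. \<bar>\<xi> $ i\<bar> \<le> int M}. ?f \<xi>))"
    unfolding sum_distrib_left[symmetric]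
    by (intro mult_left_mono sum_fourier_multiples assms) auto
  finally show ?thesis .
qed

subsection \<open>Digit expansions\<close>

text \<open>Truncations are kept as integers, scaled by \<open>b ^ m\<close>, so that digit words of
  length \<open>m\<close> can be counted by the integers in an interval.\<close>

primrec prefix_value :: "nat \<Rightarrow> (nat \<Rightarrow> nat) \<Rightarrow> nat \<Rightarrow> nat" where
  "prefix_value b d 0 = 0"
| "prefix_value b d (Suc m) = b * prefix_value b d m + d m"

lemma prefix_value_eq_sum:
  assumes "b \<ge> 1"
  shows "real (prefix_value b d m) / real b ^ m = (\<Sum>j<m. real (d j) / real b ^ Suc j)"
  using assms by (induction m) (auto simp: field_simps)

lemma prefix_value_cong: "(\<And>j. j < m \<Longrightarrow> d j = e j) \<Longrightarrow> prefix_value b d m = prefix_value b e m"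
  by (induction m) auto

text \<open>The last digit is the residue modulo \<open>b\<close>; cancelling it leaves the shorter
  prefixes.\<close>

lemma prefix_value_inj:
  assumes "\<And>j. j < m \<Longrightarrow> d j < b" "\<And>j. j < m \<Longrightarrow> e j < b"
    and "prefix_value b d m = prefix_value b e m" "j < m"
  shows "d j = e j"
  using assms
proof (induction m)
  case (Suc m)
  have b: "d m < b" "e m < b" using Suc.prems by auto
  have eq: "b * prefix_value b d m + d m = b * prefix_value b e m + e m" using Suc.prems by simp
  then have "(b * prefix_value b d m + d m) mod b = (b * prefix_value b e m + e m) mod b" by simp
  then have m: "d m = e m" using b by simp
  then have "prefix_value b d m = prefix_value b e m" using eq b by simp
  then show ?case using Suc m by (cases "j = m") auto
qed simp

text \<open>The tail after \<open>m\<close> digits lies between 0 and the tail with all digits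
  \<open>b - 1\<close>, a geometric series with sum exactly \<open>1 / b ^ m\<close>. Equality can
  occur, so the upper bound is not strict.\<close>

lemma digit_series:
  fixes d :: "nat \<Rightarrow> nat"
  assumes b: "b \<ge> 2" and d: "\<And>j. d j < b"
  shows "summable (\<lambda>j. real (d j) / real b ^ Suc j)"
    and "real (prefix_value b d m) / real b ^ m \<le> (\<Sum>j. real (d j) / real b ^ Suc j)"
    and "(\<Sum>j. real (d j) / real b ^ Suc j) \<le> (real (prefix_value b d m) + 1) / real b ^ m"
proof -
  let ?f = "\<lambda>j. real (d j) / real b ^ Suc j"
  have geom: "(\<lambda>j. (real b - 1) / real b ^ Suc (j + m)) sums (1 / real b ^ m)" for m
  proof -
    have "(\<lambda>j. (1 / real b) ^ j) sums (1 / (1 - 1 / real b))"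
      using b by (intro geometric_sums) auto
    then have "(\<lambda>j. (real b - 1) / real b ^ Suc m * (1 / real b) ^ j) sums
        ((real b - 1) / real b ^ Suc m * (1 / (1 - 1 / real b)))"
      by (rule sums_mult)
    moreover have "(real b - 1) / real b ^ Suc m * (1 / (1 - 1 / real b)) = 1 / real b ^ m"
      using b by (simp add: field_simps)
    ultimately show ?thesis by (simp add: power_add power_one_over mult_ac)
  qed
  have le: "?f (j + m) \<le> (real b - 1) / real b ^ Suc (j + m)" for j m
    using d[of "j + m"] by (intro divide_right_mono) auto
  show summ: "summable ?f"
  proof (rule summable_comparison_test')
    show "summable (\<lambda>j. (real b - 1) / real b ^ Suc j)" using geom[of 0] by (simp add: sums_iff)
    show "norm (?f j) \<le> (real b - 1) / real b ^ Suc j" if "j \<ge> 0" for j using le[of j 0] by simp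
  qed
  have split: "(\<Sum>j. ?f j) = (\<Sum>j. ?f (j + m)) + real (prefix_value b d m) / real b ^ m"
    using suminf_split_initial_segment[OF summ, of m] b prefix_value_eq_sum[of b d m] by simp
  have summ': "summable (\<lambda>j. ?f (j + m))" using summ by (subst summable_iff_shift)
  have "(\<Sum>j. ?f (j + m)) \<ge> 0" using summ' by (intro suminf_nonneg) auto
  then show "real (prefix_value b d m) / real b ^ m \<le> (\<Sum>j. ?f j)" using split by simp
  have "(\<Sum>j. ?f (j + m)) \<le> 1 / real b ^ m"
    using suminf_le[OF le summ' sums_summable[OF geom]] sums_unique[OF geom[of m]] by simp
  then show "(\<Sum>j. ?f j) \<le> (real (prefix_value b d m) + 1) / real b ^ m"
    using split by (simp add: add_divide_distrib)
qed

lemma digit_expansion_nth: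
  fixes d :: "nat \<Rightarrow> nat ^ 'n"
  assumes "b \<ge> 2" "\<And>j i. d j $ i < b"
  shows "digit_expansion b d $ i = (\<Sum>j. real (d j $ i) / real b ^ Suc j)"
proof -
  have "(\<lambda>j. (1 / real b ^ Suc j) *\<^sub>R digit_vec (d j)) sums (\<chi> i. \<Sum>j. real (d j $ i) / real b ^ Suc j)"
    unfolding sums_def
  proof (rule vec_tendstoI)
    fix i
    have "(\<lambda>j. real (d j $ i) / real b ^ Suc j) sums (\<Sum>j. real (d j $ i) / real b ^ Suc j)"
      using assms by (intro summable_sums digit_series(1)) auto
    then show "((\<lambda>n. (\<Sum>j<n. (1 / real b ^ Suc j) *\<^sub>R digit_vec (d j)) $ i) \<longlongrightarrow>
        (\<chi> i. \<Sum>j. real (d j $ i) / real b ^ Suc j) $ i) sequentially"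
      by (simp add: sums_def digit_vec_def)
  qed
  then show ?thesis unfolding digit_expansion_def by (simp add: sums_iff)
qed

lemma digit_expansion_bounds:
  fixes d :: "nat \<Rightarrow> nat ^ 'n"
  assumes "b \<ge> 2" "\<And>j i. d j $ i < b"
  shows "real (prefix_value b (\<lambda>j. d j $ i) m) \<le> real b ^ m * digit_expansion b d $ i"
    and "real b ^ m * digit_expansion b d $ i \<le> real (prefix_value b (\<lambda>j. d j $ i) m) + 1"
  using digit_series(2,3)[OF assms(1), where d = "\<lambda>j. d j $ i" and m = m] assms
  by (simp_all add: digit_expansion_nth field_simps)

lemma missing_digit_fractal_subset_unit_cube:
  assumes "digit_data b D"
  shows "missing_digit_fractal b D \<subseteq> unit_cube"
proof
  fix x assume "x \<in> missing_digit_fractal b D"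
  then obtain d where d: "x = digit_expansion b d" "\<And>j. d j \<in> D"
    by (auto simp: missing_digit_fractal_def)
  then have "b \<ge> 2" "\<And>j i. d j $ i < b" using assms by (auto simp: digit_data_def)
  from digit_expansion_bounds[OF this, where m = 0] show "x \<in> unit_cube"
    by (simp add: unit_cube_def d)
qed

lemma digit_data_finite: "digit_data b D \<Longrightarrow> finite D"
  by (rule finite_subset[OF _ finite_vec_bounded[of "{..<b}"]]) (auto simp: digit_data_def)

lemma abs_diff_le_inverse_iff:
  fixes c u v :: real
  assumes "c > 0"
  shows "\<bar>u - v\<bar> \<le> 1 / c \<longleftrightarrow> \<bar>c * u - c * v\<bar> \<le> 1"
proof -
  have "\<bar>c * u - c * v\<bar> = c * \<bar>u - v\<bar>"
    using assms by (simp flip: right_diff_distrib add: abs_mult)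
  then show ?thesis using assms by (simp add: pos_le_divide_eq mult.commute)
qed

text \<open>Digits are read off as \<open>v (Suc m) - b * v m\<close> from integers with
  \<open>v m \<le> b ^ m * x \<le> v m + 1\<close>. The expansion satisfies the same inequalities,
  so it differs from \<open>x\<close> by at most \<open>1 / b ^ m\<close> for every
  \<open>m\<close>.\<close>

lemma unit_interval_digits:
  fixes x :: real
  assumes b: "b \<ge> 2" and x: "0 \<le> x" "x \<le> 1"
  shows "\<exists>d. (\<forall>j. d j < b) \<and> x = (\<Sum>j. real (d j) / real b ^ Suc j)"
proof -
  text \<open>At \<open>x = 1\<close> the floor would give the first digit \<open>b\<close>.\<close>
  define v where "v m = (if x = 1 then int b ^ m - 1 else \<lfloor>real b ^ m * x\<rfloor>)" for m
  have v_le: "real_of_int (v m) \<le> real b ^ m * x" and v_ge: "real b ^ m * x \<le> real_of_int (v m) + 1" for m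
    unfolding v_def by (auto simp: less_imp_le)
  have v0: "v 0 = 0" using x by (auto simp: v_def floor_eq_iff)
  have step: "0 \<le> v (Suc m) - int b * v m \<and> v (Suc m) - int b * v m < int b" for m
  proof (cases "x = 1")
    case True
    then show ?thesis using b by (simp add: v_def algebra_simps)
  next
    case False
    let ?y = "real b ^ m * x"
    have v: "v m = \<lfloor>?y\<rfloor>" "v (Suc m) = \<lfloor>real b * ?y\<rfloor>" using False by (auto simp: v_def mult_ac)
    have "real b * real_of_int \<lfloor>?y\<rfloor> \<le> real b * ?y" by (intro mult_left_mono) auto
    then have "int b * \<lfloor>?y\<rfloor> \<le> \<lfloor>real b * ?y\<rfloor>" by (simp add: le_floor_iff)
    moreover have "real b * ?y < real b * (real_of_int \<lfloor>?y\<rfloor> + 1)"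
      using b by (intro mult_strict_left_mono) auto
    then have "\<lfloor>real b * ?y\<rfloor> < int b * (\<lfloor>?y\<rfloor> + 1)" by (simp add: floor_less_iff)
    ultimately show ?thesis by (simp add: v algebra_simps)
  qed
  define d where "d j = nat (v (Suc j) - int b * v j)" for j
  have d: "d j < b" for j using step[of j] by (auto simp: d_def)
  have pv: "int (prefix_value b d m) = v m" for m
  proof (induction m)
    case (Suc m)
    then show ?case using step[of m] by (simp add: d_def)
  qed (simp add: v0)
  let ?S = "\<Sum>j. real (d j) / real b ^ Suc j"
  have "\<bar>?S - x\<bar> \<le> (1 / real b) ^ m" for m
  proof -
    have "real (prefix_value b d m) = real_of_int (v m)" using pv[of m] by (metis of_int_of_nat_eq)
    then have "real_of_int (v m) \<le> real b ^ m * ?S" "real b ^ m * ?S \<le> real_of_int (v m) + 1"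
      using digit_series(2,3)[OF b, where d = d and m = m, OF d] b by (simp_all add: field_simps)
    then have "\<bar>real b ^ m * ?S - real b ^ m * x\<bar> \<le> 1"
      using v_le[of m] v_ge[of m] unfolding abs_le_iff by linarith
    then have "\<bar>?S - x\<bar> \<le> 1 / real b ^ m" using b by (subst abs_diff_le_inverse_iff) auto
    then show ?thesis by (simp add: power_one_over)
  qed
  moreover have "(\<lambda>m. (1 / real b) ^ m) \<longlonglongrightarrow> 0" using b by (intro LIMSEQ_power_zero) auto
  ultimately have "\<bar>?S - x\<bar> \<le> 0" by (intro LIMSEQ_le_const) auto
  then show ?thesis using d by (intro exI[of _ d]) auto
qed

text \<open>With all digit vectors allowed the coordinates do not constrain each other, so
  one-dimensional expansions can be chosen separately.\<close>

lemma full_digits_fractal: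
  assumes "b \<ge> 2"
  shows "missing_digit_fractal b {d. \<forall>i. d $ i < b} = (unit_cube :: (real ^ 'n) set)"
proof
  show "missing_digit_fractal b {d. \<forall>i. d $ i < b} \<subseteq> (unit_cube :: (real ^ 'n) set)"
    using assms by (intro missing_digit_fractal_subset_unit_cube) (auto simp: digit_data_def intro!: exI[of _ 0])
  show "unit_cube \<subseteq> (missing_digit_fractal b {d. \<forall>i. d $ i < b} :: (real ^ 'n) set)"
  proof
    fix x :: "real ^ 'n" assume x: "x \<in> unit_cube"
    have "\<forall>i. \<exists>d. (\<forall>j. d j < b) \<and> x $ i = (\<Sum>j. real (d j) / real b ^ Suc j)"
      using x by (intro allI unit_interval_digits[OF assms]) (auto simp: unit_cube_def)
    then obtain e where e: "\<And>i j. e i j < b" "\<And>i. x $ i = (\<Sum>j. real (e i j) / real b ^ Suc j)"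
      by metis
    define d :: "nat \<Rightarrow> nat ^ 'n" where "d j = (\<chi> i. e i j)" for j
    have "x = digit_expansion b d"
      using e assms by (simp add: vec_eq_iff digit_expansion_nth d_def)
    then show "x \<in> missing_digit_fractal b {d. \<forall>i. d $ i < b}"
      using e by (auto simp: missing_digit_fractal_def d_def)
  qed
qed

text \<open>A full digit set would give the whole cube. The strict inequality puts the exponent
  \<open>s\<close> in \<open>card D = b powr s\<close> below \<open>CARD('n)\<close>, and the final
  gain in the exponent comes from that.\<close>

lemma proper_fractal_card:
  fixes D :: "(nat ^ 'n) set"
  assumes "digit_data b D" "proper_fractal (missing_digit_fractal b D)"
  shows "card D < b ^ CARD('n)"
proof -
  have "D \<subseteq> {d. \<forall>i. d $ i < b}" using assms by (auto simp: digit_data_def)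
  moreover have "D \<noteq> {d. \<forall>i. d $ i < b}"
    using assms full_digits_fractal[of b] by (auto simp: proper_fractal_def digit_data_def)
  ultimately have "card D < card {d :: nat ^ 'n. \<forall>i. d $ i \<in> {..<b}}"
    by (intro psubset_card_mono finite_vec_bounded) auto
  then show ?thesis by (simp only: card_vec_bounded[OF finite_lessThan] card_lessThan)
qed

subsection \<open>Mass of cubes\<close>

abbreviation digit_space :: "(nat ^ 'n) set \<Rightarrow> (nat \<Rightarrow> nat ^ 'n) measure" where
  "digit_space D \<equiv> PiM UNIV (\<lambda>_::nat. measure_pmf (pmf_of_set D))"

lemma product_prob_space_digits: "product_prob_space (\<lambda>_::nat. measure_pmf (pmf_of_set D))"
  by unfold_locales

lemma prob_space_digits: "prob_space (digit_space D)"
  by (intro prob_space_PiM) unfold_locales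

lemma digit_expansion_measurable [measurable]: "digit_expansion b \<in> borel_measurable (digit_space D)"
proof -
  have [measurable]: "digit_vec \<in> borel_measurable (measure_pmf (pmf_of_set D))" by simp
  show ?thesis unfolding digit_expansion_def [abs_def] by measurable
qed

lemma prob_space_cantor_lebesgue: "prob_space (cantor_lebesgue b D)"
  unfolding cantor_lebesgue_def
  by (intro prob_space.prob_space_distr prob_space_digits) measurable

lemma sets_cantor_lebesgue [simp]: "sets (cantor_lebesgue b D) = sets borel"
  by (simp add: cantor_lebesgue_def)

lemma measure_digit_prefix:
  fixes D :: "(nat ^ 'n) set"
  assumes "finite D" "\<And>j. j < m \<Longrightarrow> d j \<in> D"
  shows "{\<omega>. \<forall>j<m. \<omega> j = d j} \<in> sets (digit_space D)"
    and "measure (digit_space D) {\<omega>. \<forall>j<m. \<omega> j = d j} = (1 / real (card D)) ^ m"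
proof -
  interpret product_prob_space "\<lambda>_::nat. measure_pmf (pmf_of_set D)" UNIV
    by (rule product_prob_space_digits)
  have emb: "prod_emb UNIV (\<lambda>_. measure_pmf (pmf_of_set D)) {..<m} (PiE {..<m} (\<lambda>j. {d j})) =
      {\<omega>. \<forall>j<m. \<omega> j = d j}"
    by (auto simp: prod_emb_def space_PiM PiE_def Pi_def)
  show "{\<omega>. \<forall>j<m. \<omega> j = d j} \<in> sets (digit_space D)"
    unfolding emb[symmetric] by (intro sets_PiM_I) auto
  have "measure (digit_space D) {\<omega>. \<forall>j<m. \<omega> j = d j} = (\<Prod>j<m. measure (measure_pmf (pmf_of_set D)) {d j})"
    unfolding emb[symmetric] by (intro measure_PiM_emb) auto
  also have "\<dots> = (\<Prod>j<m. 1 / real (card D))"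
  proof (intro prod.cong refl)
    fix j assume "j \<in> {..<m}"
    then have "d j \<in> D" using assms by auto
    then show "measure (measure_pmf (pmf_of_set D)) {d j} = 1 / real (card D)"
      using assms by (subst measure_pmf_of_set) (auto simp: Int_absorb1)
  qed
  finally show "measure (digit_space D) {\<omega>. \<forall>j<m. \<omega> j = d j} = (1 / real (card D)) ^ m" by simp
qed

text \<open>The product space also contains sequences leaving \<open>D\<close>, for which the digit
  bounds may fail. The cube estimates therefore compare events only almost everywhere.\<close>

lemma AE_digits:
  assumes "finite D" "D \<noteq> {}"
  shows "AE \<omega> in digit_space D. \<forall>j. \<omega> j \<in> D"
  unfolding AE_all_countable
proof
  fix j :: nat
  have "AE x in measure_pmf (pmf_of_set D). x \<in> D" using assms by (simp add: AE_measure_pmf_iff)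
  then show "AE \<omega> in digit_space D. \<omega> j \<in> D"
    by (rule AE_PiM_component[rotated 2]) (auto simp: measure_pmf.prob_space_axioms)
qed

text \<open>The closed ball of the maximum norm, introduced because the norm of
  \<open>real ^ 'n\<close> is Euclidean.\<close>

definition sup_cube :: "real ^ 'n \<Rightarrow> real \<Rightarrow> (real ^ 'n) set" where
  "sup_cube y r = {x. \<forall>i. \<bar>x $ i - y $ i\<bar> \<le> r}"

lemma sup_cube_borel [measurable]: "sup_cube y r \<in> sets borel"
proof -
  have "closed (sup_cube y r)" unfolding sup_cube_def
    by (intro closed_Collect_all closed_Collect_le continuous_intros)
  then show ?thesis by simp
qed

lemma sup_cube_mono: "r \<le> s \<Longrightarrow> sup_cube y r \<subseteq> sup_cube y s"
  by (auto simp: sup_cube_def intro: order_trans)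

lemma cantor_lebesgue_cube_eq:
  "measure (cantor_lebesgue b D) (sup_cube y r) =
     measure (digit_space D) (digit_expansion b -` sup_cube y r \<inter> space (digit_space D))"
  unfolding cantor_lebesgue_def by (intro measure_distr) measurable

text \<open>Almost every sequence sharing its first \<open>m\<close> digits with an expansion of
  \<open>y\<close> lands in the cube, since both expansions lie in the same \<open>b\<close>-adic
  interval in each coordinate.\<close>

lemma cantor_lebesgue_cube_ge:
  fixes D :: "(nat ^ 'n) set"
  assumes "digit_data b D" "y \<in> missing_digit_fractal b D"
  shows "(1 / real (card D)) ^ m \<le> measure (cantor_lebesgue b D) (sup_cube y (1 / real b ^ m))"
proof -
  interpret prob_space "digit_space D" by (rule prob_space_digits)
  have b: "b \<ge> 2" and D: "D \<noteq> {}" "finite D" and lt: "\<And>d i. d \<in> D \<Longrightarrow> d $ i < b"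
    using assms digit_data_finite by (auto simp: digit_data_def)
  obtain d where d: "y = digit_expansion b d" "\<And>j. d j \<in> D"
    using assms by (auto simp: missing_digit_fractal_def)
  let ?E = "digit_expansion b -` sup_cube y (1 / real b ^ m) \<inter> space (digit_space D)"
  have "(1 / real (card D)) ^ m = prob {\<omega>. \<forall>j<m. \<omega> j = d j}"
    using measure_digit_prefix(2)[of D m d] D d by simp
  also have "\<dots> \<le> prob ?E"
  proof (rule finite_measure_mono_AE)
    show "?E \<in> sets (digit_space D)" by measurable
    show "AE \<omega> in digit_space D. \<omega> \<in> {\<omega>. \<forall>j<m. \<omega> j = d j} \<longrightarrow> \<omega> \<in> ?E"
      using AE_digits[OF D(2,1)]
    proof eventually_elim
      fix \<omega> :: "nat \<Rightarrow> nat ^ 'n" assume \<omega>: "\<forall>j. \<omega> j \<in> D"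
      have "\<bar>digit_expansion b \<omega> $ i - y $ i\<bar> \<le> 1 / real b ^ m" if eq: "\<forall>j<m. \<omega> j = d j" for i
      proof -
        have "prefix_value b (\<lambda>j. \<omega> j $ i) m = prefix_value b (\<lambda>j. d j $ i) m"
          using eq by (intro prefix_value_cong) auto
        moreover have "\<And>j i. \<omega> j $ i < b" "\<And>j i. d j $ i < b" using \<omega> d lt by auto
        ultimately have "\<bar>real b ^ m * digit_expansion b \<omega> $ i - real b ^ m * y $ i\<bar> \<le> 1"
          using digit_expansion_bounds[OF b, where d = \<omega> and i = i and m = m]
            digit_expansion_bounds[OF b, where d = d and i = i and m = m]
          unfolding d(1) abs_le_iff by simp
        then show ?thesis using b by (subst abs_diff_le_inverse_iff) auto
      qed
      then show "\<omega> \<in> {\<omega>. \<forall>j<m. \<omega> j = d j} \<longrightarrow> \<omega> \<in> ?E"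
        by (auto simp: sup_cube_def space_PiM)
    qed
  qed
  finally show ?thesis by (simp only: cantor_lebesgue_cube_eq)
qed

text \<open>Bounds the number of possible truncations in one coordinate of a cube; the window has
  length 3.\<close>

lemma card_nat_window_le:
  fixes c :: real
  shows "finite {p::nat. c - 2 \<le> real p \<and> real p \<le> c + 1}"
    and "card {p::nat. c - 2 \<le> real p \<and> real p \<le> c + 1} \<le> 4"
proof -
  let ?S = "{p::nat. c - 2 \<le> real p \<and> real p \<le> c + 1}"
  have sub: "int ` ?S \<subseteq> {\<lceil>c - 2\<rceil>..\<lfloor>c + 1\<rfloor>}" by (auto; linarith)
  have "finite (int ` ?S)" by (rule finite_subset[OF sub]) simp
  then show "finite ?S" by (rule finite_imageD) (auto simp: inj_on_def)
  have "card ?S = card (int ` ?S)" by (rule card_image[symmetric]) (auto simp: inj_on_def)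
  also have "\<dots> \<le> card {\<lceil>c - 2\<rceil>..\<lfloor>c + 1\<rfloor>}" by (intro card_mono sub) simp
  also have "\<dots> \<le> 4" by simp linarith
  finally show "card ?S \<le> 4" .
qed

text \<open>In each coordinate the cube leaves at most 4 values for the integer truncation, and the
  truncations determine the first \<open>m\<close> digits. So at most \<open>4 ^ CARD('n)\<close>
  cylinders cover the event up to a null set.\<close>

lemma cantor_lebesgue_cube_le:
  fixes D :: "(nat ^ 'n) set" and y :: "real ^ 'n"
  assumes "digit_data b D"
  shows "measure (cantor_lebesgue b D) (sup_cube y (1 / real b ^ m)) \<le> 4 ^ CARD('n) * (1 / real (card D)) ^ m"
proof -
  interpret prob_space "digit_space D" by (rule prob_space_digits)
  have b: "b \<ge> 2" and D: "D \<noteq> {}" "finite D" and lt: "\<And>d i. d \<in> D \<Longrightarrow> d $ i < b"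
    using assms digit_data_finite by (auto simp: digit_data_def)
  let ?E = "digit_expansion b -` sup_cube y (1 / real b ^ m) \<inter> space (digit_space D)"
  \<comment> \<open>If \<open>p \<le> b ^ m * u \<le> p + 1\<close> and \<open>b ^ m * u\<close> is
    within 1 of \<open>b ^ m * y $ i\<close>, then \<open>p\<close> is at most 2 below and at most 1
    above the latter.\<close>
  define S where "S i = {p::nat. real b ^ m * y $ i - 2 \<le> real p \<and> real p \<le> real b ^ m * y $ i + 1}" for i
  define pv where "pv f = (\<lambda>i. prefix_value b (\<lambda>j. f j $ i) m)" for f :: "nat \<Rightarrow> nat ^ 'n"
  define G where "G = {f \<in> PiE {..<m} (\<lambda>_. D). \<forall>i. pv f i \<in> S i}"
  have finG: "finite G" unfolding G_def using D
    by (intro finite_subset[OF _ finite_PiE[of "{..<m}" "\<lambda>_. D"]]) auto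
  have "inj_on pv G"
  proof (rule inj_onI)
    fix f g assume fg: "f \<in> G" "g \<in> G" "pv f = pv g"
    have "f j $ i = g j $ i" if "j < m" for i j
    proof (rule prefix_value_inj[where d = "\<lambda>j. f j $ i" and e = "\<lambda>j. g j $ i" and b = b])
      show "prefix_value b (\<lambda>j. f j $ i) m = prefix_value b (\<lambda>j. g j $ i) m"
        using fg(3) by (auto simp: pv_def fun_eq_iff)
    qed (use fg that lt in \<open>auto simp: G_def PiE_def Pi_def\<close>)
    then show "f = g" using fg by (intro PiE_ext[of f "{..<m}" "\<lambda>_. D" g]) (auto simp: G_def vec_eq_iff)
  qed
  then have "card G = card (pv ` G)" by (simp add: card_image)
  also have "\<dots> \<le> card (PiE UNIV S)"
  proof (rule card_mono)
    show "finite (PiE UNIV S)" using card_nat_window_le(1) by (intro finite_PiE) (auto simp: S_def)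
  qed (auto simp: G_def)
  also have "\<dots> = (\<Prod>i\<in>UNIV. card (S i))" by (simp add: card_PiE)
  also have "\<dots> \<le> (\<Prod>i\<in>(UNIV :: 'n set). 4)"
    using card_nat_window_le(2) by (intro prod_mono) (auto simp: S_def)
  finally have cardG: "card G \<le> 4 ^ CARD('n)" by simp
  have "prob ?E \<le> prob (\<Union>f\<in>G. {\<omega>. \<forall>j<m. \<omega> j = f j})"
  proof (rule finite_measure_mono_AE)
    show "(\<Union>f\<in>G. {\<omega>. \<forall>j<m. \<omega> j = f j}) \<in> sets (digit_space D)"
      using finG D by (intro sets.finite_UN measure_digit_prefix(1)) (auto simp: G_def)
    show "AE \<omega> in digit_space D. \<omega> \<in> ?E \<longrightarrow> \<omega> \<in> (\<Union>f\<in>G. {\<omega>. \<forall>j<m. \<omega> j = f j})"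
      using AE_digits[OF D(2,1)]
    proof eventually_elim
      fix \<omega> :: "nat \<Rightarrow> nat ^ 'n" assume \<omega>: "\<forall>j. \<omega> j \<in> D"
      show "\<omega> \<in> ?E \<longrightarrow> \<omega> \<in> (\<Union>f\<in>G. {\<omega>. \<forall>j<m. \<omega> j = f j})"
      proof
        assume E: "\<omega> \<in> ?E"
        have "pv (restrict \<omega> {..<m}) i \<in> S i" for i
        proof -
          have "pv (restrict \<omega> {..<m}) i = prefix_value b (\<lambda>j. \<omega> j $ i) m"
            unfolding pv_def by (intro prefix_value_cong) auto
          moreover have "\<bar>digit_expansion b \<omega> $ i - y $ i\<bar> \<le> 1 / real b ^ m"
            using E by (auto simp: sup_cube_def)
          then have "\<bar>real b ^ m * digit_expansion b \<omega> $ i - real b ^ m * y $ i\<bar> \<le> 1"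
            using b by (subst (asm) abs_diff_le_inverse_iff) auto
          moreover have "\<And>j i. \<omega> j $ i < b" using \<omega> lt by auto
          ultimately show ?thesis
            using digit_expansion_bounds[OF b, where d = \<omega> and i = i and m = m] by (simp add: S_def abs_le_iff)
        qed
        then have "restrict \<omega> {..<m} \<in> G" using \<omega> by (auto simp: G_def)
        then show "\<omega> \<in> (\<Union>f\<in>G. {\<omega>. \<forall>j<m. \<omega> j = f j})" by (rule UN_I) auto
      qed
    qed
  qed
  also have "\<dots> \<le> (\<Sum>f\<in>G. prob {\<omega>. \<forall>j<m. \<omega> j = f j})"
    using finG D by (intro finite_measure_subadditive_finite) (auto simp: G_def intro!: measure_digit_prefix(1))
  also have "\<dots> = (\<Sum>f\<in>G. (1 / real (card D)) ^ m)"
    using D by (intro sum.cong refl measure_digit_prefix(2)) (auto simp: G_def)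
  also have "\<dots> = real (card G) * (1 / real (card D)) ^ m" by simp
  also have "\<dots> \<le> 4 ^ CARD('n) * (1 / real (card D)) ^ m"
  proof (rule mult_right_mono)
    show "real (card G) \<le> 4 ^ CARD('n)" using of_nat_mono[OF cardG, where 'a = real] by simp
  qed simp
  finally show ?thesis by (simp only: cantor_lebesgue_cube_eq)
qed

subsection \<open>Rational neighbourhoods\<close>

lemma fourier_coeff_0: "prob_space \<mu> \<Longrightarrow> fourier_coeff \<mu> 0 = 1"
  by (simp add: fourier_coeff_def prob_space.prob_space)

lemma real_bounded_int_vec:
  fixes Q :: real
  assumes "Q \<ge> 0"
  shows "{\<xi> :: int ^ 'n. \<forall>i. real_of_int \<bar>\<xi> $ i\<bar> \<le> Q} = {\<xi>. \<forall>i. \<xi> $ i \<in> {-int (nat \<lfloor>Q\<rfloor>)..int (nat \<lfloor>Q\<rfloor>)}}"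
proof -
  have "real_of_int \<bar>j\<bar> \<le> Q \<longleftrightarrow> j \<in> {-int (nat \<lfloor>Q\<rfloor>)..int (nat \<lfloor>Q\<rfloor>)}" for j :: int
    using assms le_floor_iff[of "\<bar>j\<bar>" Q] by (auto simp: abs_le_iff)
  then show ?thesis by simp
qed

text \<open>To extract an admissible exponent from the supremum, the set must be nonempty and
  bounded above. The zero frequency has coefficient 1, which excludes \<open>s > CARD('n)\<close>;
  bounding all coefficients by 1 shows that \<open>s = 0\<close> is admissible.\<close>

lemma l1_dim_less_witness:
  fixes \<mu> :: "(real ^ 'n) measure"
  assumes "prob_space \<mu>" "c < l1_dim \<mu>"
  obtains s C where "c < s" "0 \<le> s" "s \<le> real CARD('n)"
    "\<And>Q. Q \<ge> 1 \<Longrightarrow> (\<Sum>\<xi>\<in>{\<xi> :: int ^ 'n. \<forall>i. real_of_int \<bar>\<xi> $ i\<bar> \<le> Q}. cmod (fourier_coeff \<mu> \<xi>))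
       \<le> C * Q powr (real CARD('n) - s)"
proof -
  let ?k = "real CARD('n)"
  let ?X = "\<lambda>Q. {\<xi> :: int ^ 'n. \<forall>i. real_of_int \<bar>\<xi> $ i\<bar> \<le> Q}"
  let ?sum = "\<lambda>Q. \<Sum>\<xi>\<in>?X Q. cmod (fourier_coeff \<mu> \<xi>)"
  define S where "S = {s. s \<ge> 0 \<and> (\<exists>C. \<forall>Q::real. Q \<ge> 1 \<longrightarrow> ?sum Q \<le> C * Q powr (?k - s))}"
  have fin: "finite (?X Q)" if "Q \<ge> 1" for Q
    using that by (subst real_bounded_int_vec) (simp, intro finite_vec_bounded finite_atLeastAtMost_int)
  have le_k: "s \<le> ?k" if s: "s \<in> S" for s
  proof (rule ccontr)
    assume "\<not> s \<le> ?k"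
    obtain C where C: "\<And>Q. Q \<ge> 1 \<Longrightarrow> ?sum Q \<le> C * Q powr (?k - s)" using s by (auto simp: S_def)
    have "1 \<le> C * Q powr (?k - s)" if "Q \<ge> 1" for Q
    proof -
      have "1 = (\<Sum>\<xi>\<in>{0 :: int ^ 'n}. cmod (fourier_coeff \<mu> \<xi>))"
        using assms by (simp add: fourier_coeff_0)
      also have "\<dots> \<le> ?sum Q" using fin[OF that] that by (intro sum_mono2) auto
      also have "\<dots> \<le> C * Q powr (?k - s)" by (rule C[OF that])
      finally show ?thesis .
    qed
    then have ev: "\<forall>\<^sub>F Q in at_top. 1 \<le> C * Q powr (?k - s)"
      using eventually_ge_at_top[of 1] by (rule eventually_mono[rotated]) auto
    \<comment> \<open>The negative exponent sends the right-hand side to 0, against the lower bound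
      1.\<close>
    have "((\<lambda>Q. C * Q powr (?k - s)) \<longlongrightarrow> C * 0) at_top"
      using \<open>\<not> s \<le> ?k\<close> by (intro tendsto_mult tendsto_const tendsto_neg_powr filterlim_ident) auto
    then have "1 \<le> C * 0" by (rule tendsto_lowerbound[OF _ ev]) simp
    then show False by simp
  qed
  have "0 \<in> S"
  proof -
    have "?sum Q \<le> 3 ^ CARD('n) * Q powr (?k - 0)" if "Q \<ge> 1" for Q
    proof -
      let ?M = "nat \<lfloor>Q\<rfloor>"
      have "?sum Q \<le> (\<Sum>\<xi>\<in>?X Q. 1)"
        by (intro sum_mono fourier_coeff_le_1 assms)
      also have "\<dots> = real (card (?X Q))" by simp
      also have "\<dots> = real (card {-int ?M..int ?M}) ^ CARD('n)"
        by (subst real_bounded_int_vec)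
           (use that in \<open>simp, simp only: card_vec_bounded[OF finite_atLeastAtMost_int] of_nat_power\<close>)
      also have "\<dots> \<le> (3 * Q) ^ CARD('n)"
      proof (intro power_mono)
        have "real (card {-int ?M..int ?M}) = 2 * real ?M + 1" by simp
        \<comment> \<open>Here \<open>Q \<ge> 1\<close> absorbs the summand 1.\<close>
        also have "\<dots> \<le> 3 * Q" using that of_nat_floor[of Q] by linarith
        finally show "real (card {-int ?M..int ?M}) \<le> 3 * Q" .
      qed simp
      also have "\<dots> = 3 ^ CARD('n) * Q powr (?k - 0)"
        using that by (simp add: power_mult_distrib powr_realpow)
      finally show ?thesis .
    qed
    then show ?thesis by (auto simp: S_def)
  qed
  moreover have "bdd_above S" using le_k by (auto simp: bdd_above_def)
  moreover have "c < Sup S" using assms(2) by (simp add: l1_dim_def S_def)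
  ultimately obtain s where s: "s \<in> S" "c < s" using less_cSup_iff[of S c] by auto
  then show ?thesis using that le_k[OF s(1)] by (auto simp: S_def)
qed

section \<open>Well-approximable points as a limsup set over denominators\<close>

definition rational_nbhd :: "(real ^ 'n) set \<Rightarrow> real \<Rightarrow> nat \<Rightarrow> (real ^ 'n) set" where
  "rational_nbhd K \<tau> n = {x. \<exists>a :: int ^ 'n. (\<chi> i. real_of_int (a $ i) / real n) \<in> K \<and>
     (\<forall>i. \<bar>x $ i - real_of_int (a $ i) / real n\<bar> < real n powr (- \<tau>) / real n)}"

lemma finite_numerators:
  fixes K :: "(real ^ 'n) set"
  assumes "K \<subseteq> unit_cube" "n \<ge> 1"
  shows "finite {a :: int ^ 'n. (\<chi> i. real_of_int (a $ i) / real n) \<in> K}"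
  by (rule finite_subset[OF rational_points_numerators[OF assms]])
     (intro finite_vec_bounded finite_atLeastLessThan_int)

text \<open>Since \<open>K\<close> is bounded, each denominator admits only finitely many
  numerators; hence infinitely many pairs \<open>(a, n)\<close> amount to infinitely many
  \<open>n\<close>.\<close>

lemma W_set_eq:
  fixes K :: "(real ^ 'n) set"
  assumes "K \<subseteq> unit_cube"
  shows "W_set K \<tau> = {x. \<forall>i. 0 \<le> x $ i \<and> x $ i < 1} \<inter> (\<Inter>m. \<Union>n\<in>{m<..}. rational_nbhd K \<tau> n)"
proof -
  have "infinite {(a, n). (a :: int ^ 'n) \<in> UNIV \<and> (n::nat) \<ge> 1 \<and>
        (\<chi> i. real_of_int (a $ i) / real n) \<in> K \<and>
        (\<forall>i. \<bar>x $ i - real_of_int (a $ i) / real n\<bar> < real n powr (- \<tau>) / real n)}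
     \<longleftrightarrow> (\<forall>m. \<exists>n>m. x \<in> rational_nbhd K \<tau> n)" (is "infinite ?P \<longleftrightarrow> _") for x
  proof -
    have snd: "snd ` ?P = {n. n \<ge> 1 \<and> x \<in> rational_nbhd K \<tau> n}"
      by (force simp: rational_nbhd_def image_iff)
    have "finite ?P" if "finite (snd ` ?P)"
    proof (rule finite_subset)
      let ?Q = "\<Union>n\<in>snd ` ?P. {a :: int ^ 'n. (\<chi> i. real_of_int (a $ i) / real n) \<in> K} \<times> {n}"
      show "?P \<subseteq> ?Q" by force
      show "finite ?Q" using that
        by (intro finite_UN_I finite_cartesian_product finite_numerators[OF assms]) auto
    qed
    then have "infinite ?P \<longleftrightarrow> infinite {n. n \<ge> 1 \<and> x \<in> rational_nbhd K \<tau> n}"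
      unfolding snd[symmetric] by blast
    also have "\<dots> \<longleftrightarrow> (\<forall>m. \<exists>n>m. x \<in> rational_nbhd K \<tau> n)"
      unfolding infinite_nat_iff_unbounded
      by (metis (no_types, lifting) mem_Collect_eq One_nat_def Suc_leI gr_zeroI not_less_zero)
    finally show ?thesis .
  qed
  then show ?thesis unfolding W_set_def by auto
qed

lemma rational_nbhd_borel [measurable]: "rational_nbhd K \<tau> n \<in> sets borel"
proof -
  have "open (rational_nbhd K \<tau> n)" unfolding rational_nbhd_def
    unfolding Collect_ex_eq Collect_conj_eq Collect_all_eq
    by (intro open_UN open_Int open_INT open_Collect_less open_Collect_const continuous_intros ballI) auto
  then show ?thesis by simp
qed

lemma W_set_borel:
  fixes K :: "(real ^ 'n) set"
  assumes "K \<subseteq> unit_cube"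
  shows "W_set K \<tau> \<in> sets borel"
proof -
  have "{x :: real ^ 'n. \<forall>i. 0 \<le> x $ i \<and> x $ i < 1} \<in> sets borel"
    by measurable
  then show ?thesis unfolding W_set_eq[OF assms] by measurable
qed

lemma rational_nbhd_antimono:
  assumes "\<tau> \<le> \<tau>'" "n \<ge> 1"
  shows "rational_nbhd K \<tau>' n \<subseteq> rational_nbhd K \<tau> n"
proof -
  have "real n powr (- \<tau>') / real n \<le> real n powr (- \<tau>) / real n"
    using assms by (intro divide_right_mono powr_mono) auto
  then show ?thesis unfolding rational_nbhd_def by (blast intro: less_le_trans)
qed

text \<open>Every denominator lies in a block from \<open>b ^ t\<close> to \<open>b ^ Suc t\<close>.
  Monotonicity in the exponent lets the single \<open>\<tau>\<close> serve all larger
  exponents.\<close>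

lemma W_set_subset_limsup:
  fixes K :: "(real ^ 'n) set"
  assumes "K \<subseteq> unit_cube" "b \<ge> 2" "\<tau> \<le> \<tau>'"
  shows "W_set K \<tau>' \<subseteq> limsup (\<lambda>t. \<Union>n\<in>{b ^ t..<b ^ Suc t}. rational_nbhd K \<tau> n)"
proof
  fix x assume "x \<in> W_set K \<tau>'"
  then have x: "\<exists>n>m. x \<in> rational_nbhd K \<tau>' n" for m
    unfolding W_set_eq[OF assms(1)] by auto
  have "\<exists>t\<ge>T. \<exists>n\<in>{b ^ t..<b ^ Suc t}. x \<in> rational_nbhd K \<tau> n" for T
  proof -
    obtain n where n: "n > b ^ T" "x \<in> rational_nbhd K \<tau>' n" using x by blast
    then obtain t where t: "b ^ t \<le> n" "n < b ^ (t + 1)" using ex_power_ivl1[OF assms(2), of n] by auto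
    have "b ^ T < b ^ (t + 1)" using n t by linarith
    then have "T \<le> t" using assms(2) power_less_imp_less_exp[of b T "t + 1"] by simp
    moreover have "x \<in> rational_nbhd K \<tau> n" using n rational_nbhd_antimono[OF assms(3), of n K] by auto
    ultimately show ?thesis using t by (intro exI[of _ t]) auto
  qed
  then show "x \<in> limsup (\<lambda>t. \<Union>n\<in>{b ^ t..<b ^ Suc t}. rational_nbhd K \<tau> n)"
    by (auto simp: limsup_INF_SUP Bex_def)
qed

text \<open>The condition on \<open>r\<close> gives \<open>b ^ r \<le> n powr (1 + \<tau>)\<close>
  throughout the block, so each neighbourhood is covered by cubes of radius \<open>1 / b ^ r\<close>
  about the rational points of \<open>K\<close>, to which the upper mass bound applies.\<close>

lemma measure_rational_nbhd_block_le_count: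
  fixes D :: "(nat ^ 'n) set"
  assumes D: "digit_data b D" and \<tau>: "1 + \<tau> \<ge> 0" and r: "real r \<le> (1 + \<tau>) * real t"
  defines "K \<equiv> missing_digit_fractal b D"
  shows "measure (cantor_lebesgue b D) (\<Union>n\<in>{b ^ t..<b ^ Suc t}. rational_nbhd K \<tau> n) \<le>
    (\<Sum>n\<in>{b ^ t..<b ^ Suc t}. real (card {a :: int ^ 'n. (\<chi> i. real_of_int (a $ i) / real n) \<in> K})) *
      (4 ^ CARD('n) * (1 / real (card D)) ^ r)"
proof -
  interpret prob_space "cantor_lebesgue b D" by (rule prob_space_cantor_lebesgue)
  let ?c = "4 ^ CARD('n) * (1 / real (card D)) ^ r"
  let ?A = "\<lambda>n. {a :: int ^ 'n. (\<chi> i. real_of_int (a $ i) / real n) \<in> K}"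
  have b: "b \<ge> 2" using D by (simp add: digit_data_def)
  have K: "K \<subseteq> unit_cube" unfolding K_def by (rule missing_digit_fractal_subset_unit_cube[OF D])
  have single: "prob (rational_nbhd K \<tau> n) \<le> real (card (?A n)) * ?c" if "n \<in> {b ^ t..<b ^ Suc t}" for n
  proof -
    have n: "b ^ t \<le> n" "n \<ge> 1"
      using that b one_le_power[of b t] unfolding atLeastLessThan_iff by linarith+
    have "real b ^ r \<le> real b powr ((1 + \<tau>) * real t)"
      using b r by (simp flip: powr_realpow)
    also have "\<dots> = (real b ^ t) powr (1 + \<tau>)"
      using b by (simp add: powr_powr mult_ac flip: powr_realpow)
    also have "\<dots> \<le> real n powr (1 + \<tau>)"
      using n \<tau> of_nat_mono[OF n(1), where 'a = real] by (intro powr_mono2) auto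
    finally have "1 / real n powr (1 + \<tau>) \<le> 1 / real b ^ r"
      using b n(2) by (intro divide_left_mono) (auto intro!: mult_pos_pos)
    moreover have "real n powr (- \<tau>) / real n = 1 / real n powr (1 + \<tau>)"
      using n by (simp add: powr_add powr_minus divide_simps)
    ultimately have rad: "real n powr (- \<tau>) / real n \<le> 1 / real b ^ r" by simp
    let ?y = "\<lambda>a :: int ^ 'n. (\<chi> i. real_of_int (a $ i) / real n) :: real ^ 'n"
    have fin: "finite (?A n)" by (rule finite_numerators[OF K n(2)])
    have "rational_nbhd K \<tau> n \<subseteq> (\<Union>a\<in>?A n. sup_cube (?y a) (1 / real b ^ r))"
      using less_le_trans[OF _ rad] by (auto simp: rational_nbhd_def sup_cube_def) (meson less_imp_le)
    then have "prob (rational_nbhd K \<tau> n) \<le> prob (\<Union>a\<in>?A n. sup_cube (?y a) (1 / real b ^ r))"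
      using fin by (intro finite_measure_mono) (auto simp: sup_cube_borel)
    also have "\<dots> \<le> (\<Sum>a\<in>?A n. prob (sup_cube (?y a) (1 / real b ^ r)))"
      using fin by (intro finite_measure_subadditive_finite) (auto simp: sup_cube_borel)
    also have "\<dots> \<le> (\<Sum>a\<in>?A n. ?c)"
      by (intro sum_mono cantor_lebesgue_cube_le[OF D])
    finally show ?thesis by simp
  qed
  have "prob (\<Union>n\<in>{b ^ t..<b ^ Suc t}. rational_nbhd K \<tau> n) \<le> (\<Sum>n\<in>{b ^ t..<b ^ Suc t}. prob (rational_nbhd K \<tau> n))"
    by (intro finite_measure_subadditive_finite) (auto simp: rational_nbhd_borel)
  also have "\<dots> \<le> (\<Sum>n\<in>{b ^ t..<b ^ Suc t}. real (card (?A n)) * ?c)"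
    by (intro sum_mono single)
  finally show ?thesis by (simp only: sum_distrib_right)
qed

text \<open>Points are counted at scale \<open>1 / b ^ m\<close>, while their neighbourhoods are
  measured at scale \<open>1 / b ^ r\<close>. Keeping \<open>m\<close> and \<open>r\<close>
  independent leaves room to choose a finer counting scale later.\<close>

lemma measure_rational_nbhd_block_le:
  fixes D :: "(nat ^ 'n) set"
  assumes D: "digit_data b D" and \<tau>: "1 + \<tau> \<ge> 0" and r: "real r \<le> (1 + \<tau>) * real t"
    and C: "C \<ge> 0" "\<And>j::nat. 1 \<le> j \<Longrightarrow> j \<le> b ^ m \<Longrightarrow> real (card {d. d dvd j}) \<le> C"
  defines "\<mu> \<equiv> cantor_lebesgue b D"
  shows "measure \<mu> (\<Union>n\<in>{b ^ t..<b ^ Suc t}. rational_nbhd (missing_digit_fractal b D) \<tau> n) \<le>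
    16 ^ CARD('n) * real (card D) ^ (m + 3) * (1 / real (card D)) ^ r *
      (2 * real (b ^ Suc t) / real (b ^ m)) ^ CARD('n) *
      (real (b ^ Suc t) + C * (\<Sum>\<xi>\<in>{\<xi>. \<forall>i. \<bar>\<xi> $ i\<bar> \<le> int (b ^ m)}. cmod (fourier_coeff \<mu> \<xi>)))"
proof -
  let ?K = "missing_digit_fractal b D" and ?q = "real (card D)"
  let ?N = "\<Sum>n\<in>{b ^ t..<b ^ Suc t}. real (card {a :: int ^ 'n. (\<chi> i. real_of_int (a $ i) / real n) \<in> ?K})"
  let ?R = "(2 * real (b ^ Suc t) / real (b ^ m)) ^ CARD('n) *
      (real (b ^ Suc t) + C * (\<Sum>\<xi>\<in>{\<xi>. \<forall>i. \<bar>\<xi> $ i\<bar> \<le> int (b ^ m)}. cmod (fourier_coeff \<mu> \<xi>)))"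
  have b: "b \<ge> 2" using D by (simp add: digit_data_def)
  have q: "?q > 0" using D digit_data_finite[OF D] by (simp add: digit_data_def card_gt_0_iff)
  have mass: "(1 / ?q) ^ (m + 3) \<le> measure \<mu> {x. \<forall>i. \<bar>x $ i - y $ i\<bar> \<le> 1 / (8 * real (b ^ m))}" if "y \<in> ?K" for y
  proof -
    interpret prob_space \<mu> unfolding \<mu>_def by (rule prob_space_cantor_lebesgue)
    \<comment> \<open>Three further digits suffice to fit inside radius
      \<open>1 / (8 * b ^ m)\<close>, because \<open>b ^ 3 \<ge> 8\<close>.\<close>
    have "(2::real) ^ 3 \<le> real b ^ 3" using b by (intro power_mono) auto
    then have "real b ^ m * 8 \<le> real b ^ m * real b ^ 3" by (intro mult_left_mono) auto
    then have "8 * real (b ^ m) \<le> real b ^ (m + 3)" by (simp add: power_add)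
    then have "1 / real b ^ (m + 3) \<le> 1 / (8 * real (b ^ m))"
      using b by (intro divide_left_mono) auto
    then have "measure \<mu> (sup_cube y (1 / real b ^ (m + 3))) \<le> measure \<mu> (sup_cube y (1 / (8 * real (b ^ m))))"
      by (intro finite_measure_mono sup_cube_mono) (simp_all add: \<mu>_def sup_cube_borel)
    with cantor_lebesgue_cube_ge[OF D that, of "m + 3"] show ?thesis
      by (simp add: \<mu>_def sup_cube_def)
  qed
  have count: "?N * ((1 / ?q) ^ (m + 3) / 4 ^ CARD('n)) \<le> ?R"
  proof (rule card_rational_points)
    show "prob_space \<mu>" "sets \<mu> = sets borel" by (simp_all add: \<mu>_def prob_space_cantor_lebesgue)
    show "?K \<subseteq> unit_cube" by (rule missing_digit_fractal_subset_unit_cube[OF D])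
  qed (use b C mass in auto)
  have "measure \<mu> (\<Union>n\<in>{b ^ t..<b ^ Suc t}. rational_nbhd ?K \<tau> n) \<le> ?N * (4 ^ CARD('n) * (1 / ?q) ^ r)"
    unfolding \<mu>_def by (rule measure_rational_nbhd_block_le_count[OF D \<tau> r])
  \<comment> \<open>One factor \<open>4 ^ CARD('n)\<close> comes from the upper mass bound, the
    other from the lower bound for the kernel.\<close>
  also have "\<dots> = (16 ^ CARD('n) * ?q ^ (m + 3) * (1 / ?q) ^ r) * (?N * ((1 / ?q) ^ (m + 3) / 4 ^ CARD('n)))"
  proof -
    have "(16::real) ^ CARD('n) = 4 ^ CARD('n) * 4 ^ CARD('n)" by (simp flip: power_mult_distrib)
    moreover have "?q ^ (m + 3) * (1 / ?q) ^ (m + 3) = 1" using q by (simp add: power_one_over)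
    ultimately show ?thesis using q
      by (simp add: field_simps power_one_over)
  qed
  also have "\<dots> \<le> (16 ^ CARD('n) * ?q ^ (m + 3) * (1 / ?q) ^ r) * ?R"
    using count by (rule mult_left_mono) simp
  finally show ?thesis by (simp only: mult.assoc)
qed

subsection \<open>Summability of the blocks\<close>

text \<open>For \<open>N = \<beta> ^ t\<close> and \<open>M\<close> about
  \<open>N powr \<theta>\<close>, the prefactor is of order at most \<open>N powr E\<close>. The two
  summands, \<open>N\<close> from the zero frequency and \<open>M powr e\<close> from the others,
  turn into two geometric sequences.\<close>

lemma block_bound_geometric:
  fixes \<beta> q s \<theta> \<tau> e C :: real and m r t k :: nat
  assumes \<beta>: "\<beta> \<ge> 1" and q: "q = \<beta> powr s" and s: "s \<ge> 0"
    and m: "\<theta> * t \<le> m" "m \<le> \<theta> * t + 1" and r: "(1 + \<tau>) * t - 1 \<le> r"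
    and e: "e \<ge> 0" and C: "C \<ge> 0"
  defines "E \<equiv> s * (\<theta> - 1 - \<tau>) + k - \<theta> * k"
  shows "q ^ (m + 3) * (1 / q) ^ r * (2 * \<beta> ^ Suc t / \<beta> ^ m) ^ k * (\<beta> ^ Suc t + C * (\<beta> ^ m) powr e)
    \<le> (2 * \<beta>) ^ k * \<beta> powr (5 * s) * (\<beta> * (\<beta> powr (E + 1)) ^ t + C * \<beta> powr e * (\<beta> powr (E + \<theta> * e)) ^ t)"
proof -
  have "q ^ (m + 3) * (1 / q) ^ r * (2 * \<beta> ^ Suc t / \<beta> ^ m) ^ k =
      (2 * \<beta>) ^ k * \<beta> powr (s * (m + 3) - s * r + (real t - real m) * k)"
  proof -
    have "q ^ (m + 3) * (1 / q) ^ r = \<beta> powr (s * (m + 3) - s * r)"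
    proof -
      have "q ^ j = \<beta> powr (s * real j)" for j
        using \<beta> by (simp add: q powr_power mult.commute)
      then show ?thesis by (simp add: power_one_over powr_diff)
    qed
    moreover have "(2 * \<beta> ^ Suc t / \<beta> ^ m) ^ k = (2 * \<beta>) ^ k * (\<beta> ^ t / \<beta> ^ m) ^ k"
    proof -
      have "2 * \<beta> ^ Suc t / \<beta> ^ m = (2 * \<beta>) * (\<beta> ^ t / \<beta> ^ m)" by simp
      then show ?thesis by (simp only: power_mult_distrib)
    qed
    moreover have "(\<beta> ^ t / \<beta> ^ m) ^ k = \<beta> powr ((real t - real m) * k)"
      using \<beta> by (simp add: powr_powr flip: powr_realpow powr_diff)
    ultimately show ?thesis by (simp add: powr_add)
  qed
  also have "\<dots> \<le> (2 * \<beta>) ^ k * \<beta> powr (5 * s + E * t)"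
  proof -
    \<comment> \<open>The 5 is 3 for the additional digits plus 1 for each of the roundings of
      \<open>m\<close> and \<open>r\<close>.\<close>
    have "s * (real m + 3 - real r) \<le> s * (\<theta> * t + 5 - (1 + \<tau>) * t)"
      using m r s by (intro mult_left_mono) auto
    moreover have "(real t - real m) * k \<le> (t - \<theta> * t) * k"
      using m by (intro mult_right_mono) auto
    ultimately have "s * (m + 3) - s * r + (real t - real m) * k \<le> 5 * s + E * t"
      by (simp add: E_def algebra_simps)
    then show ?thesis using \<beta> by (intro mult_left_mono powr_mono) auto
  qed
  finally have 1: "q ^ (m + 3) * (1 / q) ^ r * (2 * \<beta> ^ Suc t / \<beta> ^ m) ^ k
      \<le> (2 * \<beta>) ^ k * \<beta> powr (5 * s + E * t)" .
  have "(\<beta> ^ m) powr e = \<beta> powr (m * e)"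
    using \<beta> by (simp add: powr_powr flip: powr_realpow)
  also have "\<dots> \<le> \<beta> powr ((\<theta> * t + 1) * e)"
    using \<beta> m e by (intro powr_mono mult_right_mono) auto
  finally have 2: "\<beta> ^ Suc t + C * (\<beta> ^ m) powr e \<le> \<beta> * \<beta> powr t + C * \<beta> powr ((\<theta> * t + 1) * e)"
    using \<beta> C by (intro add_mono mult_left_mono) (auto simp: powr_realpow)
  have "q ^ (m + 3) * (1 / q) ^ r * (2 * \<beta> ^ Suc t / \<beta> ^ m) ^ k * (\<beta> ^ Suc t + C * (\<beta> ^ m) powr e)
    \<le> (2 * \<beta>) ^ k * \<beta> powr (5 * s + E * t) * (\<beta> * \<beta> powr t + C * \<beta> powr ((\<theta> * t + 1) * e))"
    using \<beta> C by (intro mult_mono[OF 1 2]) auto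
  also have "\<dots> = (2 * \<beta>) ^ k * \<beta> powr (5 * s) *
      (\<beta> * (\<beta> powr (E * t) * \<beta> powr t) + C * \<beta> powr e * (\<beta> powr (E * t) * \<beta> powr (\<theta> * t * e)))"
    by (simp add: powr_add distrib_left distrib_right mult_ac)
  also have "\<beta> powr (E * t) * \<beta> powr t = (\<beta> powr (E + 1)) ^ t"
    using \<beta> by (simp add: powr_power algebra_simps flip: powr_add)
  also have "\<beta> powr (E * t) * \<beta> powr (\<theta> * t * e) = (\<beta> powr (E + \<theta> * e)) ^ t"
    using \<beta> by (simp add: powr_power algebra_simps flip: powr_add)
  finally show ?thesis .
qed

text \<open>At scale \<open>M\<close> the Fourier sum has exponent \<open>CARD('n) - l\<close> and
  the divisor bound adds \<open>\<delta>\<close>. The two conditions on \<open>E\<close> say that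
  the geometric sequences from the zero and from the nonzero frequencies have ratios below
  1.\<close>

lemma summable_measure_blocks:
  fixes D :: "(nat ^ 'n) set"
  assumes D: "digit_data b D" and s: "real (card D) = real b powr s" "s \<ge> 0"
    and \<tau>: "1 + \<tau> \<ge> 0" and \<theta>: "\<theta> \<ge> 0" and \<delta>: "\<delta> > 0"
    and l: "l \<le> real CARD('n)" "\<And>Q. Q \<ge> 1 \<Longrightarrow>
       (\<Sum>\<xi>\<in>{\<xi> :: int ^ 'n. \<forall>i. real_of_int \<bar>\<xi> $ i\<bar> \<le> Q}. cmod (fourier_coeff (cantor_lebesgue b D) \<xi>))
       \<le> C * Q powr (real CARD('n) - l)"
  defines "E \<equiv> s * (\<theta> - 1 - \<tau>) + real CARD('n) - \<theta> * real CARD('n)"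
  assumes E: "E + 1 < 0" "E + \<theta> * (\<delta> + real CARD('n) - l) < 0"
  shows "summable (\<lambda>t. measure (cantor_lebesgue b D)
     (\<Union>n\<in>{b ^ t..<b ^ Suc t}. rational_nbhd (missing_digit_fractal b D) \<tau> n))"
proof -
  let ?\<mu> = "cantor_lebesgue b D" and ?k = "CARD('n)" and ?\<beta> = "real b" and ?q = "real (card D)"
  let ?V = "\<lambda>t. \<Union>n\<in>{b ^ t..<b ^ Suc t}. rational_nbhd (missing_digit_fractal b D) \<tau> n"
  let ?e = "\<delta> + real ?k - l"
  have b: "b \<ge> 2" using D by (simp add: digit_data_def)
  obtain A where A: "A > 0" "\<And>m::nat. m > 0 \<Longrightarrow> real (card {d. d dvd m}) \<le> A * real m powr \<delta>"
    using divisor_bound[OF \<delta>] by blast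
  define B where "B = A * C"
  \<comment> \<open>Forced by the bound at \<open>Q = 1\<close>, whose left-hand side is
    nonnegative.\<close>
  have "C \<ge> 0"
  proof -
    have "0 \<le> C * 1 powr (real ?k - l)"
      by (rule order_trans[OF sum_nonneg l(2)]) auto
    then show ?thesis by simp
  qed
  then have B: "B \<ge> 0" using A by (simp add: B_def)
  let ?g = "\<lambda>t. 16 ^ ?k * ((2 * ?\<beta>) ^ ?k * ?\<beta> powr (5 * s) *
      (?\<beta> * (?\<beta> powr (E + 1)) ^ t + B * ?\<beta> powr ?e * (?\<beta> powr (E + \<theta> * ?e)) ^ t))"
  have le: "measure ?\<mu> (?V t) \<le> ?g t" for t
  proof -
    \<comment> \<open>Rounding up keeps the counting scale at least as fine as intended;
      \<open>r\<close> is rounded down so that cubes of radius \<open>1 / b ^ r\<close> still cover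
      the neighbourhoods.\<close>
    define m where "m = nat \<lceil>\<theta> * real t\<rceil>"
    define r where "r = nat \<lfloor>(1 + \<tau>) * real t\<rfloor>"
    have "\<theta> * real t \<ge> 0" "(1 + \<tau>) * real t \<ge> 0" using \<theta> \<tau> by auto
    then have m: "\<theta> * t \<le> m" "m \<le> \<theta> * t + 1" and r: "(1 + \<tau>) * t - 1 \<le> r" "real r \<le> (1 + \<tau>) * t"
      unfolding m_def r_def by linarith+
    let ?M = "real (b ^ m)"
    let ?S = "\<Sum>\<xi>\<in>{\<xi> :: int ^ 'n. \<forall>i. \<bar>\<xi> $ i\<bar> \<le> int (b ^ m)}. cmod (fourier_coeff ?\<mu> \<xi>)"
    have M: "?M \<ge> 1" using b by simp
    have iff: "real_of_int \<bar>j\<bar> \<le> ?M \<longleftrightarrow> \<bar>j\<bar> \<le> int (b ^ m)" for j :: int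
      by (metis of_int_le_iff of_int_of_nat_eq)
    have S: "?S \<le> C * ?M powr (real ?k - l)"
      using l(2)[OF M] unfolding iff .
    have "measure ?\<mu> (?V t) \<le> 16 ^ ?k * ?q ^ (m + 3) * (1 / ?q) ^ r *
      (2 * real (b ^ Suc t) / ?M) ^ ?k * (real (b ^ Suc t) + A * ?M powr \<delta> * ?S)"
    proof (rule measure_rational_nbhd_block_le[OF D \<tau> r(2)])
      fix j :: nat assume j: "1 \<le> j" "j \<le> b ^ m"
      then have "real (card {d. d dvd j}) \<le> A * real j powr \<delta>" by (intro A(2)) auto
      also have "\<dots> \<le> A * ?M powr \<delta>"
        using A(1) \<delta> of_nat_mono[OF j(2), where 'a = real] by (intro mult_left_mono powr_mono2) auto
      finally show "real (card {d. d dvd j}) \<le> A * ?M powr \<delta>" .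
    qed (use A in auto)
    also have "\<dots> \<le> 16 ^ ?k * ?q ^ (m + 3) * (1 / ?q) ^ r *
      (2 * real (b ^ Suc t) / ?M) ^ ?k * (real (b ^ Suc t) + A * ?M powr \<delta> * (C * ?M powr (real ?k - l)))"
      using S A(1) by (intro mult_left_mono add_left_mono) auto
    also have "A * ?M powr \<delta> * (C * ?M powr (real ?k - l)) = B * (?\<beta> ^ m) powr ?e"
      by (simp add: B_def powr_add powr_diff)
    also have "16 ^ ?k * ?q ^ (m + 3) * (1 / ?q) ^ r *
      (2 * real (b ^ Suc t) / ?M) ^ ?k * (real (b ^ Suc t) + B * (?\<beta> ^ m) powr ?e) =
      16 ^ ?k * (?q ^ (m + 3) * (1 / ?q) ^ r *
      (2 * ?\<beta> ^ Suc t / ?\<beta> ^ m) ^ ?k * (?\<beta> ^ Suc t + B * (?\<beta> ^ m) powr ?e))"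
      by (simp only: mult.assoc of_nat_power)
    also have "\<dots> \<le> ?g t"
      unfolding E_def
      by (intro mult_left_mono block_bound_geometric s m r B) (use b \<delta> l(1) in auto)
    finally show ?thesis .
  qed
  have "\<bar>?\<beta> powr x\<bar> < 1" if "x < 0" for x
    using b that powr_less_mono[of x 0 ?\<beta>] by simp
  then have "summable ?g"
    using E by (intro summable_mult summable_add summable_geometric) auto
  then show ?thesis
    by (rule summable_comparison_test'[where N = 0]) (use le in auto)
qed

text \<open>At \<open>\<theta> = 1 + 1 / k\<close> and \<open>\<epsilon> = 0\<close> the first
  expression is exactly 0. Raising \<open>\<theta>\<close> by \<open>\<eta>\<close> lowers it by
  \<open>\<eta> * (k - s)\<close>, while \<open>\<epsilon>\<close> costs
  \<open>s * \<epsilon>\<close>. The second expression starts at \<open>- g\<close> apart from the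
  term in \<open>\<delta>\<close>, so small parameters keep it negative.\<close>

lemma exponent_choice:
  fixes k s l :: real
  assumes k: "k \<ge> 1" and s: "0 \<le> s" "s < k" and l: "k - k / (k + 1) < l"
  obtains \<epsilon> \<theta> \<delta> where "0 < \<epsilon>" "\<epsilon> \<le> 1" "0 < \<delta>" "0 \<le> \<theta>"
    "s * (\<theta> - 1 - (1 / k - \<epsilon>)) + k - \<theta> * k + 1 < 0"
    "s * (\<theta> - 1 - (1 / k - \<epsilon>)) + k - \<theta> * k + \<theta> * (\<delta> + k - l) < 0"
proof -
  \<comment> \<open>Positive by the hypothesis on \<open>l\<close>, because
    \<open>k - k / (k + 1) = k / (1 + 1 / k)\<close>.\<close>
  define g where "g = (1 + 1 / k) * l - k"
  have "k = (1 + 1 / k) * (k - k / (k + 1))" using k by (simp add: divide_simps) (simp add: algebra_simps)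
  also have "\<dots> < (1 + 1 / k) * l" using k l by (intro mult_strict_left_mono) (auto simp: add_pos_pos)
  finally have g: "g > 0" by (simp add: g_def)
  \<comment> \<open>Ensures
    \<open>s * (\<eta> + \<epsilon>) \<le> 2 * k * \<eta> \<le> g / 2\<close>; the minimum with 1
    keeps \<open>\<theta> \<le> 2 + 1 / k\<close>.\<close>
  define \<eta> where "\<eta> = min 1 (g / (4 * k))"
  \<comment> \<open>Makes \<open>k * \<epsilon>\<close> half of the gain
    \<open>\<eta> * (k - s)\<close>, so that \<open>s * \<epsilon>\<close> cannot use it up.\<close>
  define \<epsilon> where "\<epsilon> = \<eta> * (k - s) / (2 * k)"
  \<comment> \<open>With \<open>\<theta> \<le> 2 + 1 / k\<close> this gives
    \<open>\<theta> * \<delta> \<le> g / 4\<close>, which together with \<open>g / 2\<close> stays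
    below \<open>g\<close>.\<close>
  define \<delta> where "\<delta> = g / (4 * (2 + 1 / k))"
  define \<theta> where "\<theta> = 1 + 1 / k + \<eta>"
  have \<eta>: "0 < \<eta>" "\<eta> \<le> 1" "\<eta> * (4 * k) \<le> g"
    using g k by (auto simp: \<eta>_def pos_le_divide_eq[symmetric])
  have \<epsilon>: "0 < \<epsilon>" using \<eta> s k by (simp add: \<epsilon>_def)
  have k\<epsilon>: "2 * (k * \<epsilon>) = \<eta> * (k - s)" using k by (simp add: \<epsilon>_def)
  have "k * \<epsilon> \<le> k * \<eta>"
  proof -
    have "\<eta> * (k - s) \<le> \<eta> * k" using \<eta> s by (intro mult_left_mono) auto
    moreover have "\<eta> * k \<ge> 0" using \<eta> k by auto
    ultimately show ?thesis using k\<epsilon> by (simp add: mult.commute)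
  qed
  then have \<epsilon>\<eta>: "\<epsilon> \<le> \<eta>" using k by simp
  have l0: "l \<ge> 0"
  proof -
    have "k / (k + 1) \<le> k" using k by (simp add: field_simps)
    then show ?thesis using l by linarith
  qed
  have "s * \<epsilon> \<le> k * \<epsilon>" using s \<epsilon> by (intro mult_right_mono) auto
  moreover have "\<eta> * (k - s) > 0" using \<eta> s by simp
  ultimately have "s * \<epsilon> < \<eta> * (k - s)" using k\<epsilon> by linarith
  moreover have "s * (\<theta> - 1 - (1 / k - \<epsilon>)) + k - \<theta> * k + 1 = s * \<epsilon> - \<eta> * (k - s)"
    using k by (simp add: \<theta>_def algebra_simps)
  ultimately have E1: "s * (\<theta> - 1 - (1 / k - \<epsilon>)) + k - \<theta> * k + 1 < 0" by simp
  have "s * (\<eta> + \<epsilon>) \<le> k * (2 * \<eta>)" using s \<eta> \<epsilon> \<epsilon>\<eta> by (intro mult_mono) auto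
  moreover have "\<theta> * \<delta> \<le> g / 4"
  proof -
    have "\<theta> * \<delta> \<le> (2 + 1 / k) * \<delta>" using \<eta> g k by (intro mult_right_mono) (auto simp: \<theta>_def \<delta>_def)
    also have "\<dots> = g / 4"
    proof -
      have "c * (g / (4 * c)) = g / 4" if "c > 0" for c using that by simp
      moreover have "2 + 1 / k > 0" using k by (simp add: add_pos_pos)
      ultimately show ?thesis unfolding \<delta>_def by blast
    qed
    finally show ?thesis .
  qed
  moreover have "\<eta> * l \<ge> 0" using \<eta> l0 by simp
  ultimately have "s * (\<eta> + \<epsilon>) - g - \<eta> * l + \<theta> * \<delta> < 0" using \<eta>(3) g by (simp add: algebra_simps)
  moreover have "s * (\<theta> - 1 - (1 / k - \<epsilon>)) + k - \<theta> * k + \<theta> * (\<delta> + k - l) = s * (\<eta> + \<epsilon>) - g - \<eta> * l + \<theta> * \<delta>"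
    by (simp add: \<theta>_def g_def algebra_simps add_divide_distrib)
  ultimately have E2: "s * (\<theta> - 1 - (1 / k - \<epsilon>)) + k - \<theta> * k + \<theta> * (\<delta> + k - l) < 0" by simp
  have "\<delta> > 0" using g k by (simp add: \<delta>_def add_pos_pos)
  moreover have "\<theta> \<ge> 0" using \<eta> k by (simp add: \<theta>_def)
  ultimately show ?thesis using that[of \<epsilon> \<delta> \<theta>] \<epsilon> \<epsilon>\<eta> \<eta> E1 E2 by linarith
qed

theorem theorem1p17:
  fixes b :: nat and D :: "(nat ^ 'n) set"
  assumes "digit_data b D"
    and "proper_fractal (missing_digit_fractal b D)"
    and "l1_dim (cantor_lebesgue b D) > real CARD('n) - real CARD('n) / (real CARD('n) + 1)"
  shows "\<exists>\<epsilon>>0. \<forall>\<tau>. \<tau> > 1 / real CARD('n) - \<epsilon> \<longrightarrow>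
           W_set (missing_digit_fractal b D) \<tau> \<in> null_sets (cantor_lebesgue b D)"
proof -
  let ?k = "real CARD('n)" and ?\<mu> = "cantor_lebesgue b D" and ?K = "missing_digit_fractal b D"
  interpret prob_space ?\<mu> by (rule prob_space_cantor_lebesgue)
  have b: "b \<ge> 2" using assms(1) by (simp add: digit_data_def)
  have K: "?K \<subseteq> unit_cube" by (rule missing_digit_fractal_subset_unit_cube[OF assms(1)])
  obtain l C where l: "?k - ?k / (?k + 1) < l" "l \<le> ?k" "\<And>Q. Q \<ge> 1 \<Longrightarrow>
       (\<Sum>\<xi>\<in>{\<xi> :: int ^ 'n. \<forall>i. real_of_int \<bar>\<xi> $ i\<bar> \<le> Q}. cmod (fourier_coeff ?\<mu> \<xi>)) \<le> C * Q powr (?k - l)"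
    using l1_dim_less_witness[OF prob_space_axioms assms(3)] by blast
  have k: "?k \<ge> 1" using one_le_card_finite[where 'a = 'n] by simp
  \<comment> \<open>The similarity dimension of the fractal, nonnegative because \<open>D\<close> is
    nonempty.\<close>
  define s where "s = log (real b) (real (card D))"
  have card: "card D \<ge> 1" using assms(1) digit_data_finite[OF assms(1)]
    by (simp add: digit_data_def card_gt_0_iff Suc_le_eq)
  have s: "real (card D) = real b powr s" "0 \<le> s" using card b by (auto simp: s_def)
  have "real (card D) < real (b ^ CARD('n))"
    using proper_fractal_card[OF assms(1,2)] by (simp only: of_nat_less_iff)
  then have "real b powr s < real b powr ?k" using b s by (simp add: powr_realpow)
  then have "s < ?k" using b by simp
  then obtain \<epsilon> \<theta> \<delta> where \<epsilon>: "0 < \<epsilon>" "\<epsilon> \<le> 1" and par: "0 < \<delta>" "0 \<le> \<theta>"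
    "s * (\<theta> - 1 - (1 / ?k - \<epsilon>)) + ?k - \<theta> * ?k + 1 < 0"
    "s * (\<theta> - 1 - (1 / ?k - \<epsilon>)) + ?k - \<theta> * ?k + \<theta> * (\<delta> + ?k - l) < 0"
    using exponent_choice[OF _ s(2) _ l(1)] k by blast
  let ?\<tau> = "1 / ?k - \<epsilon>"
  let ?V = "\<lambda>t. \<Union>n\<in>{b ^ t..<b ^ Suc t}. rational_nbhd ?K ?\<tau> n"
  have "1 / ?k \<ge> 0" by simp
  \<comment> \<open>The choice \<open>\<epsilon> \<le> 1\<close> serves this: it keeps
    \<open>n powr (1 + \<tau>)\<close> monotone in \<open>n\<close>, as the covering by cubes
    requires.\<close>
  then have "1 + ?\<tau> \<ge> 0" using \<epsilon> by linarith
  then have "summable (\<lambda>t. measure ?\<mu> (?V t))"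
    using summable_measure_blocks[OF assms(1) s _ par(2,1) l(2,3) par(3,4)] by blast
  then have "limsup ?V \<in> null_sets ?\<mu>"
    by (intro borel_cantelli_limsup1) (auto simp: rational_nbhd_borel emeasure_eq_measure)
  \<comment> \<open>The measure is not completed, so lying inside the null limsup set has to be
    combined with \<open>W_set\<close> being Borel.\<close>
  then have "W_set ?K \<tau> \<in> null_sets ?\<mu>" if "\<tau> > ?\<tau>" for \<tau>
    using null_sets_subset[OF _ _ W_set_subset_limsup[OF K b, of ?\<tau> \<tau>]] that W_set_borel[OF K]
    by auto
  with \<epsilon> show ?thesis by blast
qed

end
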